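(* Let $V$ be a vector space over $\Bbbk$ with ordered basis $\{x_1,\ldots,x_n\}$, let $\mu\in M(n,\Bbbk)$ be multiplicatively antisymmetric, and let $\phi:V\times V\to\Bbbk$ be a $\mu$-symmetric bilinear form relative to this basis. If the skew Clifford algebra $\mathrm{sCl}(V,\mu,\phi)$ is not $\{0\}$, then $\dim_{\Bbbk}(\mathrm{sCl}(V,\mu,\phi)) = 2^j$ for some integer $j$ with $1\le j\le \dim(V)$.
   Context: $\Bbbk$ is a field with $\mathrm{char}(\Bbbk)\neq 2$, $n\geq 1$, and $M(n,\Bbbk)$ is the space of $n\times n$ matrices over $\Bbbk$. A matrix $\mu=(\mu_{ij})\in M(n,\Bbbk)$ is multiplicatively antisymmetric if $\mu_{ij}\mu_{ji}=\mu_{ii}=1$ for all $i,j$. A bilinear form $\phi:V\times V\to\Bbbk$ is $\mu$-symmetric (relative to the basis $\{x_1,\ldots,x_n\}$) if $\phi(x_i,x_j)=\mu_{ij}\phi(x_j,x_i)$ for all $i,j$. The skew Clifford algebra $\mathrm{sCl}(V,\mu,\phi)$ is the quotient of the tensor algebra $T(V)$ by the two-sided ideal generated by all elements $x_i\otimes x_j+\mu_{ij}\,x_j\otimes x_i-2\phi(x_i,x_j)\cdot 1$, for all $i,j\in\{1,\ldots,n\}$. *)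

theory Defs
  imports "HOL-Library.Poly_Mapping" "HOL-Algebra.Algebra" "HOL-Algebra.Algebraic_Closure_Type"
begin

section \<open>Bases, bilinear forms and matrices of parameters\<close>

definition ordered_basis ::
    "('k::field \<Rightarrow> 'v::ab_group_add \<Rightarrow> 'v) \<Rightarrow> nat \<Rightarrow> (nat \<Rightarrow> 'v) \<Rightarrow> bool" where
  "ordered_basis scale n x \<longleftrightarrow>
     inj_on x {1..n} \<and>
     \<not> Modules.module.dependent scale (x ` {1..n}) \<and>
     Modules.module.span scale (x ` {1..n}) = UNIV"

definition bilinear_form ::
    "('k::field \<Rightarrow> 'v::ab_group_add \<Rightarrow> 'v) \<Rightarrow> ('v \<Rightarrow> 'v \<Rightarrow> 'k) \<Rightarrow> bool" where
  "bilinear_form scale \<phi> \<longleftrightarrow>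
     (\<forall>v. Vector_Spaces.linear scale (*) (\<lambda>w. \<phi> v w)) \<and>
     (\<forall>w. Vector_Spaces.linear scale (*) (\<lambda>v. \<phi> v w))"

text \<open>An \<open>n \<times> n\<close> matrix is a function of two indices; only the entries with indices in
  \<open>{1..n}\<close> are ever used.\<close>

definition mult_antisymmetric :: "nat \<Rightarrow> (nat \<Rightarrow> nat \<Rightarrow> 'k::field) \<Rightarrow> bool" where
  "mult_antisymmetric n \<mu> \<longleftrightarrow>
     (\<forall>i\<in>{1..n}. \<forall>j\<in>{1..n}. \<mu> i j * \<mu> j i = 1 \<and> \<mu> i i = 1)"

definition mu_symmetric ::
    "nat \<Rightarrow> (nat \<Rightarrow> 'v) \<Rightarrow> (nat \<Rightarrow> nat \<Rightarrow> 'k::field) \<Rightarrow> ('v \<Rightarrow> 'v \<Rightarrow> 'k) \<Rightarrow> bool" where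
  "mu_symmetric n x \<mu> \<phi> \<longleftrightarrow>
     (\<forall>i\<in>{1..n}. \<forall>j\<in>{1..n}. \<phi> (x i) (x j) = \<mu> i j * \<phi> (x j) (x i))"


section \<open>The tensor algebra\<close>

text \<open>Words under concatenation form a monoid, written additively so that the convolution product
  on \<^typ>\<open>'a \<Rightarrow>\<^sub>0 'b\<close> makes \<open>'v word \<Rightarrow>\<^sub>0 'k\<close> its monoid algebra, i.e. the free unital associative
  \<open>'k\<close>-algebra on the set of all vectors.\<close>

datatype 'v word = Word (letters: "'v list")

instantiation word :: (type) monoid_add
begin

definition zero_word :: "'a word" where
  "zero_word = Word []"

definition plus_word :: "'a word \<Rightarrow> 'a word \<Rightarrow> 'a word" where
  "plus_word u w = Word (letters u @ letters w)"

instance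
  by standard (simp_all add: zero_word_def plus_word_def)

end

type_synonym ('v, 'k) free_alg = "'v word \<Rightarrow>\<^sub>0 'k"

definition free_gen :: "'v \<Rightarrow> ('v, 'k::field) free_alg" where
  "free_gen v = Poly_Mapping.single (Word [v]) 1"

definition free_scalar :: "'k::field \<Rightarrow> ('v, 'k) free_alg" where
  "free_scalar c = Poly_Mapping.single 0 c"

text \<open>The ideal generated by the following elements is spanned by the multilinearity relations in
  all words; hence in each length \<open>m\<close> the quotient is the \<open>m\<close>-th tensor power of the space, with the
  class of \<open>Word [v\<^sub>1, \<dots>, v\<^sub>m]\<close> being the pure tensor of the \<open>v\<^sub>i\<close>.\<close>

definition tensor_relations ::
    "('k::field \<Rightarrow> 'v::ab_group_add \<Rightarrow> 'v) \<Rightarrow> ('v, 'k) free_alg set" where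
  "tensor_relations scale =
     {free_gen (v + w) - free_gen v - free_gen w | v w. True} \<union>
     {free_gen (scale c v) - free_scalar c * free_gen v | c v. True}"

definition tensor_ideal ::
    "('k::field \<Rightarrow> 'v::ab_group_add \<Rightarrow> 'v) \<Rightarrow> ('v, 'k) free_alg set" where
  "tensor_ideal scale = Idl\<^bsub>ring_of_type_algebra\<^esub> (tensor_relations scale)"

definition tensor_algebra ::
    "('k::field \<Rightarrow> 'v::ab_group_add \<Rightarrow> 'v) \<Rightarrow> ('v, 'k) free_alg set ring" where
  "tensor_algebra scale = ring_of_type_algebra Quot (tensor_ideal scale)"

definition tensor_gen ::
    "('k::field \<Rightarrow> 'v::ab_group_add \<Rightarrow> 'v) \<Rightarrow> 'v \<Rightarrow> ('v, 'k) free_alg set" where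
  "tensor_gen scale v = tensor_ideal scale +>\<^bsub>ring_of_type_algebra\<^esub> free_gen v"

definition tensor_scalar ::
    "('k::field \<Rightarrow> 'v::ab_group_add \<Rightarrow> 'v) \<Rightarrow> 'k \<Rightarrow> ('v, 'k) free_alg set" where
  "tensor_scalar scale c = tensor_ideal scale +>\<^bsub>ring_of_type_algebra\<^esub> free_scalar c"


section \<open>Skew Clifford algebras\<close>

definition skew_clifford_relations ::
    "('k::field \<Rightarrow> 'v::ab_group_add \<Rightarrow> 'v) \<Rightarrow> nat \<Rightarrow> (nat \<Rightarrow> 'v) \<Rightarrow> (nat \<Rightarrow> nat \<Rightarrow> 'k) \<Rightarrow>
      ('v \<Rightarrow> 'v \<Rightarrow> 'k) \<Rightarrow> ('v, 'k) free_alg set set" where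
  "skew_clifford_relations scale n x \<mu> \<phi> =
     (let T = tensor_algebra scale; e = (\<lambda>i. tensor_gen scale (x i)) in
      {(e i \<otimes>\<^bsub>T\<^esub> e j) \<oplus>\<^bsub>T\<^esub> (tensor_scalar scale (\<mu> i j) \<otimes>\<^bsub>T\<^esub> (e j \<otimes>\<^bsub>T\<^esub> e i))
         \<ominus>\<^bsub>T\<^esub> tensor_scalar scale (2 * \<phi> (x i) (x j)) | i j. i \<in> {1..n} \<and> j \<in> {1..n}})"

definition skew_clifford_ideal ::
    "('k::field \<Rightarrow> 'v::ab_group_add \<Rightarrow> 'v) \<Rightarrow> nat \<Rightarrow> (nat \<Rightarrow> 'v) \<Rightarrow> (nat \<Rightarrow> nat \<Rightarrow> 'k) \<Rightarrow>
      ('v \<Rightarrow> 'v \<Rightarrow> 'k) \<Rightarrow> ('v, 'k) free_alg set set" where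
  "skew_clifford_ideal scale n x \<mu> \<phi> =
     Idl\<^bsub>tensor_algebra scale\<^esub> (skew_clifford_relations scale n x \<mu> \<phi>)"

definition sCl ::
    "('k::field \<Rightarrow> 'v::ab_group_add \<Rightarrow> 'v) \<Rightarrow> nat \<Rightarrow> (nat \<Rightarrow> 'v) \<Rightarrow> (nat \<Rightarrow> nat \<Rightarrow> 'k) \<Rightarrow>
      ('v \<Rightarrow> 'v \<Rightarrow> 'k) \<Rightarrow> ('v, 'k) free_alg set set ring" where
  "sCl scale n x \<mu> \<phi> = tensor_algebra scale Quot (skew_clifford_ideal scale n x \<mu> \<phi>)"

definition sCl_scalar ::
    "('k::field \<Rightarrow> 'v::ab_group_add \<Rightarrow> 'v) \<Rightarrow> nat \<Rightarrow> (nat \<Rightarrow> 'v) \<Rightarrow> (nat \<Rightarrow> nat \<Rightarrow> 'k) \<Rightarrow>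
      ('v \<Rightarrow> 'v \<Rightarrow> 'k) \<Rightarrow> 'k \<Rightarrow> ('v, 'k) free_alg set set" where
  "sCl_scalar scale n x \<mu> \<phi> c =
     skew_clifford_ideal scale n x \<mu> \<phi> +>\<^bsub>tensor_algebra scale\<^esub> tensor_scalar scale c"

text \<open>A scalar \<open>c\<close> acts as multiplication by \<open>c \<cdot> 1\<close>, so the dimension over the base field is the
  dimension over the image of the base field.  That image is a copy of the base field as soon as
  the algebra is nonzero (see \<open>subfield_sCl_scalars\<close> below), which is required for
  \<^const>\<open>ring.dimension\<close> to be meaningful.\<close>

definition sCl_has_dim ::
    "('k::field \<Rightarrow> 'v::ab_group_add \<Rightarrow> 'v) \<Rightarrow> nat \<Rightarrow> (nat \<Rightarrow> 'v) \<Rightarrow> (nat \<Rightarrow> nat \<Rightarrow> 'k) \<Rightarrow>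
      ('v \<Rightarrow> 'v \<Rightarrow> 'k) \<Rightarrow> nat \<Rightarrow> bool" where
  "sCl_has_dim scale n x \<mu> \<phi> d \<longleftrightarrow>
     ring.dimension (sCl scale n x \<mu> \<phi>) d (range (sCl_scalar scale n x \<mu> \<phi>))
       (carrier (sCl scale n x \<mu> \<phi>))"


section \<open>Well-definedness\<close>

lemma ring_ring_of_type_algebra: "ring (ring_of_type_algebra :: 'a::ring_1 ring)"
proof -
  have "\<exists>y. x + y = 0" for x :: 'a
    using add.right_inverse by blast
  thus ?thesis
    unfolding ring_of_type_algebra_def
    by unfold_locales (auto simp: algebra_simps Units_def)
qed

lemma ideal_tensor_ideal: "ideal (tensor_ideal scale) ring_of_type_algebra"
  unfolding tensor_ideal_def
  by (rule ring.genideal_ideal[OF ring_ring_of_type_algebra]) (simp add: ring_of_type_algebra_def)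

lemma ring_tensor_algebra: "ring (tensor_algebra scale)"
  unfolding tensor_algebra_def by (rule ideal.quotient_is_ring[OF ideal_tensor_ideal])

lemma tensor_proj_hom:
  "a_r_coset ring_of_type_algebra (tensor_ideal scale)
     \<in> ring_hom ring_of_type_algebra (tensor_algebra scale)"
  unfolding tensor_algebra_def by (rule ideal.rcos_ring_hom[OF ideal_tensor_ideal])

lemma tensor_gen_closed: "tensor_gen scale v \<in> carrier (tensor_algebra scale)"
  unfolding tensor_gen_def
  by (rule ring_hom_closed[OF tensor_proj_hom]) (simp add: ring_of_type_algebra_def)

lemma free_scalar_hom: "free_scalar \<in> ring_hom ring_of_type_algebra ring_of_type_algebra"
  by (rule ring_hom_memI)
    (auto simp: ring_of_type_algebra_def free_scalar_def single_add mult_single)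

lemma tensor_scalar_hom:
  "tensor_scalar scale \<in> ring_hom ring_of_type_algebra (tensor_algebra scale)"
proof -
  have "tensor_scalar scale = a_r_coset ring_of_type_algebra (tensor_ideal scale) \<circ> free_scalar"
    by (simp add: fun_eq_iff tensor_scalar_def)
  thus ?thesis using ring_hom_trans[OF free_scalar_hom tensor_proj_hom] by simp
qed

lemma tensor_scalar_closed: "tensor_scalar scale c \<in> carrier (tensor_algebra scale)"
  by (rule ring_hom_closed[OF tensor_scalar_hom]) (simp add: ring_of_type_algebra_def)

lemma ideal_skew_clifford_ideal:
  "ideal (skew_clifford_ideal scale n x \<mu> \<phi>) (tensor_algebra scale)"
proof -
  interpret T: ring "tensor_algebra scale" by (rule ring_tensor_algebra)
  show ?thesis
    unfolding skew_clifford_ideal_def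
    by (rule T.genideal_ideal)
      (auto simp: skew_clifford_relations_def Let_def tensor_gen_closed tensor_scalar_closed)
qed

lemma ring_sCl: "ring (sCl scale n x \<mu> \<phi>)"
  unfolding sCl_def by (rule ideal.quotient_is_ring[OF ideal_skew_clifford_ideal])

lemma sCl_scalar_hom:
  "sCl_scalar scale n x \<mu> \<phi> \<in> ring_hom ring_of_type_algebra (sCl scale n x \<mu> \<phi>)"
proof -
  have "sCl_scalar scale n x \<mu> \<phi> =
      a_r_coset (tensor_algebra scale) (skew_clifford_ideal scale n x \<mu> \<phi>) \<circ> tensor_scalar scale"
    by (simp add: fun_eq_iff sCl_scalar_def)
  moreover have "a_r_coset (tensor_algebra scale) (skew_clifford_ideal scale n x \<mu> \<phi>)
      \<in> ring_hom (tensor_algebra scale) (sCl scale n x \<mu> \<phi>)"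
    unfolding sCl_def by (rule ideal.rcos_ring_hom[OF ideal_skew_clifford_ideal])
  ultimately show ?thesis using ring_hom_trans[OF tensor_scalar_hom] by simp
qed

lemma subfield_sCl_scalars:
  fixes scale :: "'k::field \<Rightarrow> 'v::ab_group_add \<Rightarrow> 'v"
  assumes "carrier (sCl scale n x \<mu> \<phi>) \<noteq> {\<zero>\<^bsub>sCl scale n x \<mu> \<phi>\<^esub>}"
  shows "subfield (range (sCl_scalar scale n x \<mu> \<phi>)) (sCl scale n x \<mu> \<phi>)"
proof -
  let ?A = "sCl scale n x \<mu> \<phi>"
  let ?K = "ring_of_type_algebra :: 'k ring"
  interpret A: ring ?A by (rule ring_sCl)
  interpret K: field ?K by (rule field_from_type_algebra)
  interpret h: ring_hom_ring ?K ?A "sCl_scalar scale n x \<mu> \<phi>"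
    by (rule ring_hom_ringI2[OF K.ring_axioms A.ring_axioms sCl_scalar_hom])
  have "\<one>\<^bsub>?A\<^esub> \<noteq> \<zero>\<^bsub>?A\<^esub>" using assms A.one_zeroD by auto
  hence "subfield (sCl_scalar scale n x \<mu> \<phi> ` carrier ?K) ?A"
    using h.img_is_subfield(2)[OF K.carrier_is_subfield] by simp
  thus ?thesis by (simp add: ring_of_type_algebra_def)
qed

end

theory Submission
  imports Defs "HOL-Library.Function_Algebras"
begin

text \<open>
  Write \<open>X\<^sub>i\<close> for the class of the basis vector \<open>x\<^sub>i\<close> in the algebra \<open>A = sCl(V, \<mu>, \<phi>)\<close> and
  \<open>b\<^sub>i\<^sub>j = \<phi>(x\<^sub>i, x\<^sub>j)\<close>.  The relations say that products may be reordered, so \<open>A\<close> is spanned by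
  ordered monomials without repetition.  They are linearly independent exactly when reducing
  \<open>X\<^sub>i X\<^sub>j X\<^sub>k\<close> in the two possible ways gives the same result, and the difference of the two results
  is always a \<^emph>\<open>linear\<close> combination of \<open>X\<^sub>i\<close>, \<open>X\<^sub>j\<close>, \<open>X\<^sub>k\<close> (lemma \<open>overlap_in_J\<close>).  So the only
  way in which \<open>A\<close> can be smaller than \<open>2\<^sup>n\<close> is that generators become linearly dependent.

  Suppose \<open>A \<noteq> 0\<close>.  Let \<open>S\<close> (called \<open>leading\<close> below) consist of the indices \<open>m\<close> for which \<open>X\<^sub>m\<close> is
  nonzero and not a scalar multiple of an earlier generator.  Two observations show that the
  monomials in the generators from \<open>S\<close> form a basis, so that the dimension is \<open>2\<close> to the size of \<open>S\<close>.

  First, the overlap relations among indices in \<open>S\<close> hold trivially (\<open>leading_homogeneous\<close>): if one of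
  the three values of the form vanishes, at most two terms are left, and two distinct generators from
  \<open>S\<close> are independent; if none vanishes, then the relation with two equal indices forces all the
  parameters \<open>\<mu>\<close> involved to be \<open>1\<close>.  What remains is the statement
  that \<open>b\<^sub>j\<^sub>k \<noteq> 0\<close> implies \<open>\<mu>\<^sub>i\<^sub>j \<mu>\<^sub>i\<^sub>k = 1\<close>, which is precisely what makes a Fock representation
  of dimension \<open>2\<close> to the size of \<open>S\<close> satisfy the relations (\<open>fock_op_relation\<close>).

  Second, discarding the other generators loses no information (\<open>reduction_compatible\<close>): if
  \<open>X\<^sub>m = c X\<^sub>k\<close> and \<open>X\<^sub>j = d X\<^sub>l\<close> with \<open>k, l \<in> S\<close>, then the relation between \<open>X\<^sub>m\<close> and \<open>X\<^sub>j\<close> is a multiple of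
  the one between \<open>X\<^sub>k\<close> and \<open>X\<^sub>l\<close>.  Otherwise \<open>X\<^sub>l X\<^sub>k\<close> would be a scalar; this scalar is \<open>0\<close>, and
  \<open>X\<^sub>l X\<^sub>k = 0\<close> forces all the basis vectors involved into the radical of the form
  (\<open>zero_product_isotropic\<close>).  But the sign change of a basis vector in the radical is an automorphism
  of \<open>A\<close>, and it destroys any proportionality with another generator, because \<open>2 \<noteq> 0\<close>
  (\<open>isotropic_not_proportional\<close>).

  Hence the Fock representation of \<open>S\<close> is a representation of \<open>A\<close>, in which different monomials create
  different basis states.  Finally \<open>S\<close> is not empty: if all generators vanished,
  then so would \<open>\<phi>\<close>, and \<open>A\<close> would have a representation in which \<open>X\<^sub>1\<close> acts as a nonzero nilpotent.
\<close>

section \<open>Modules over the free algebra\<close>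

abbreviation free_scale :: "'k::field \<Rightarrow> ('v, 'k) free_alg \<Rightarrow> ('v, 'k) free_alg" where
  "free_scale c p \<equiv> free_scalar c * p"

lemma free_scalar_0 [simp]: "free_scalar 0 = 0"
  and free_scalar_1 [simp]: "free_scalar 1 = 1"
  and free_scalar_add: "free_scalar (c + d) = free_scalar c + free_scalar d"
  and free_scalar_diff: "free_scalar (c - d) = free_scalar c - free_scalar d"
  and free_scalar_uminus: "free_scalar (- c) = - free_scalar c"
  and free_scalar_mult: "free_scalar (c * d) = free_scalar c * free_scalar d"
  by (simp_all add: free_scalar_def single_add single_diff single_uminus mult_single)

lemma free_alg_induct [case_names single add]:
  fixes p :: "('v, 'k::field) free_alg"
  assumes single: "\<And>w c. P (Poly_Mapping.single w c)"
    and add: "\<And>p q. P p \<Longrightarrow> P q \<Longrightarrow> P (p + q)"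
  shows "P p"
proof (induction p rule: update_induct)
  case const
  show ?case using single[of 0 0] by simp
next
  case (update f a b)
  have "Poly_Mapping.update a b f = Poly_Mapping.single a b + f"
    using update.hyps
    by (intro poly_mapping_eqI) (auto simp: lookup_update lookup_add lookup_single in_keys_iff when_def)
  thus ?case using add[OF single update.IH] by simp
qed

lemma free_scalar_commute: "p * free_scalar c = free_scalar c * p"
  by (induction p rule: free_alg_induct)
    (simp_all add: free_scalar_def mult_single distrib_left distrib_right mult.commute)

lemma free_scalar_left_commute: "p * (free_scalar c * q) = free_scalar c * (p * q)"
  by (metis free_scalar_commute mult.assoc)

lemma vector_space_free_scale: "vector_space free_scale"
  by standard
    (simp_all add: distrib_left distrib_right free_scalar_add free_scalar_mult mult.assoc)

text \<open>
  The module structure over the free algebra determined by letting each letter \<open>v\<close> act as the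
  operator \<open>g v\<close>.
\<close>

definition act :: "('k::field \<Rightarrow> 'm::ab_group_add \<Rightarrow> 'm) \<Rightarrow> ('v \<Rightarrow> 'm \<Rightarrow> 'm) \<Rightarrow>
    ('v, 'k) free_alg \<Rightarrow> 'm \<Rightarrow> 'm" where
  "act s g p y = (\<Sum>w\<in>Poly_Mapping.keys p. s (Poly_Mapping.lookup p w) (foldr g (letters w) y))"

locale free_action = vector_space s
  for s :: "'k::field \<Rightarrow> 'm::ab_group_add \<Rightarrow> 'm" +
  fixes g :: "'v \<Rightarrow> 'm \<Rightarrow> 'm"
  assumes g_linear: "Vector_Spaces.linear s s (g v)"
begin

lemma g_add: "g v (y + z) = g v y + g v z" and g_scale: "g v (s c y) = s c (g v y)"
  using g_linear[of v] by (auto simp: Vector_Spaces.linear_iff)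

lemma foldr_add: "foldr g vs (y + z) = foldr g vs y + foldr g vs z"
  by (induction vs) (simp_all add: g_add)

lemma foldr_scale: "foldr g vs (s c y) = s c (foldr g vs y)"
  by (induction vs) (simp_all add: g_scale)

lemma act_single: "act s g (Poly_Mapping.single w c) y = s c (foldr g (letters w) y)"
  by (cases "c = 0") (simp_all add: act_def)

lemma act_superset:
  assumes "finite W" "Poly_Mapping.keys p \<subseteq> W"
  shows "act s g p y = (\<Sum>w\<in>W. s (Poly_Mapping.lookup p w) (foldr g (letters w) y))"
  unfolding act_def using assms by (intro sum.mono_neutral_left) (auto simp: in_keys_iff)

lemma act_add_left: "act s g (p + q) y = act s g p y + act s g q y"
proof -
  let ?W = "Poly_Mapping.keys p \<union> Poly_Mapping.keys q"
  have "finite ?W" by simp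
  moreover have "Poly_Mapping.keys (p + q) \<subseteq> ?W" by (rule Poly_Mapping.keys_add)
  ultimately show ?thesis
    by (simp add: act_superset[of ?W] lookup_add scale_left_distrib sum.distrib)
qed

lemma act_add_right: "act s g p (y + z) = act s g p y + act s g p z"
  by (simp add: act_def foldr_add scale_right_distrib sum.distrib)

lemma act_mult: "act s g (p * q) y = act s g p (act s g q y)"
proof (induction p arbitrary: y rule: free_alg_induct)
  case (single w c)
  show ?case
  proof (induction q arbitrary: y rule: free_alg_induct)
    case (single w' d)
    show ?case
      by (simp add: mult_single act_single foldr_scale plus_word_def)
  next
    case (add p q)
    thus ?case by (simp add: distrib_left act_add_left act_add_right)
  qed
next
  case (add p q)
  thus ?case by (simp add: distrib_right act_add_left)
qed

lemma act_gen [simp]: "act s g (free_gen v) y = g v y"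
  by (simp add: free_gen_def act_single)

lemma act_scalar [simp]: "act s g (free_scalar c) y = s c y"
  by (simp add: free_scalar_def act_single zero_word_def)

lemma act_one [simp]: "act s g 1 y = y"
  using act_scalar[of 1 y] by simp

lemma act_zero [simp]: "act s g 0 y = 0"
  by (simp add: act_def)

lemma act_uminus: "act s g (- p) y = - act s g p y"
  using act_add_left[of p "- p" y] by (simp add: eq_neg_iff_add_eq_0 add.commute)

lemma act_diff_left: "act s g (p - q) y = act s g p y - act s g q y"
  using act_add_left[of p "- q" y] by (simp add: act_uminus)

lemma act_sum_left: "act s g (\<Sum>i\<in>I. p i) y = (\<Sum>i\<in>I. act s g (p i) y)"
  by (induction I rule: infinite_finite_induct) (simp_all add: act_add_left)

text \<open>
  Together with \<open>act_mult\<close> this makes the set of elements that map the whole module into \<open>N\<close> a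
  two-sided ideal; this is how relations are transported to a representation modulo \<open>N\<close>.
\<close>

lemma act_invariant:
  assumes "subspace N" "\<And>v y. y \<in> N \<Longrightarrow> g v y \<in> N" "y \<in> N"
  shows "act s g p y \<in> N"
proof -
  have "foldr g vs y \<in> N" for vs
    by (induction vs) (simp_all add: assms)
  thus ?thesis
    unfolding act_def by (intro subspace_sum subspace_scale assms(1))
qed

end

section \<open>The Fock representation\<close>

abbreviation (input) fun_scale :: "'k::field \<Rightarrow> ('a \<Rightarrow> 'k) \<Rightarrow> 'a \<Rightarrow> 'k" where
  "fun_scale c f \<equiv> (\<lambda>a. c * f a)"

lemma vector_space_fun_scale: "vector_space fun_scale"
  by standard (simp_all add: fun_eq_iff algebra_simps)

lemma sum_fun_apply: "(\<Sum>i\<in>I. f i) a = (\<Sum>i\<in>I. f i a)"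
  by (induction I rule: infinite_finite_induct) simp_all

text \<open>
  The operators by which generators act on the span of the ordered monomials in the list \<open>xs\<close>.
  A monomial is encoded by the list of booleans that marks the generators occurring in it, and a
  vector by its coefficient function.  Splitting off the first generator \<open>p\<close>, a vector is \<open>u + X\<^sub>p v\<close>
  with \<open>u\<close>, \<open>v\<close> free of \<open>p\<close>; then \<open>X\<^sub>p (u + X\<^sub>p v) = b\<^sub>p\<^sub>p v + X\<^sub>p u\<close>, while the relation between \<open>X\<^sub>i\<close>
  and \<open>X\<^sub>p\<close> dictates \<open>X\<^sub>i (u + X\<^sub>p v) = (X\<^sub>i u + 2 b\<^sub>i\<^sub>p v) - \<mu>\<^sub>i\<^sub>p X\<^sub>p (X\<^sub>i v)\<close> for \<open>i \<noteq> p\<close>.  Only the values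
  at boolean lists as long as \<open>xs\<close> carry meaning.
\<close>

fun fock_op :: "(nat \<Rightarrow> nat \<Rightarrow> 'k::field) \<Rightarrow> (nat \<Rightarrow> nat \<Rightarrow> 'k) \<Rightarrow> nat list \<Rightarrow> nat \<Rightarrow>
    (bool list \<Rightarrow> 'k) \<Rightarrow> bool list \<Rightarrow> 'k" where
  "fock_op \<mu> b (p # xs) i f (True # bs) =
     (if i = p then f (False # bs) else - \<mu> i p * fock_op \<mu> b xs i (\<lambda>cs. f (True # cs)) bs)"
| "fock_op \<mu> b (p # xs) i f (False # bs) =
     (if i = p then b p p * f (True # bs)
      else fock_op \<mu> b xs i (\<lambda>cs. f (False # cs)) bs + 2 * b i p * f (True # bs))"
| "fock_op \<mu> b _ i f _ = 0"

lemma fock_op_add: "fock_op \<mu> b xs i (\<lambda>bs. f bs + g bs) cs = fock_op \<mu> b xs i f cs + fock_op \<mu> b xs i g cs"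
  by (induction \<mu> b xs i f cs arbitrary: g rule: fock_op.induct)
    (simp_all add: distrib_left)

lemma fock_op_scale: "fock_op \<mu> b xs i (\<lambda>bs. c * f bs) cs = c * fock_op \<mu> b xs i f cs"
  by (induction \<mu> b xs i f cs rule: fock_op.induct) (simp_all add: algebra_simps)

lemma fock_op_zero: "fock_op \<mu> b xs i (\<lambda>bs. 0) cs = 0"
  using fock_op_scale[of \<mu> b xs i 0 "\<lambda>_. 0" cs] by simp

lemma fock_op_uminus: "fock_op \<mu> b xs i (\<lambda>bs. - f bs) cs = - fock_op \<mu> b xs i f cs"
  using fock_op_scale[of \<mu> b xs i "-1" f cs] by simp

lemma fock_op_cong:
  assumes "\<And>bs. length bs = length xs \<Longrightarrow> f bs = g bs" "length cs = length xs"
  shows "fock_op \<mu> b xs i f cs = fock_op \<mu> b xs i g cs"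
  using assms by (induction \<mu> b xs i f cs arbitrary: g rule: fock_op.induct) auto

text \<open>
  The homogeneity condition on \<open>b\<close> says that \<open>X\<^sub>j X\<^sub>k\<close> commutes with every \<open>X\<^sub>i\<close> up to lower terms
  whenever this product contributes a nonzero scalar.  It also covers coinciding indices:
  \<open>i = j\<close> gives \<open>\<mu>\<^sub>j\<^sub>k = 1\<close> whenever \<open>b\<^sub>j\<^sub>k \<noteq> 0\<close>, and \<open>j = k\<close> gives \<open>\<mu>\<^sub>i\<^sub>j\<^sup>2 = 1\<close> whenever \<open>b\<^sub>j\<^sub>j \<noteq> 0\<close>.
  In the induction step with \<open>i\<close>, \<open>j\<close>, \<open>p\<close> distinct, comparing the terms in \<open>X\<^sub>i v\<close>, \<open>X\<^sub>j v\<close> and \<open>X\<^sub>p v\<close>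
  leaves exactly three instances of it.
\<close>

lemma fock_op_relation:
  fixes \<mu> b :: "nat \<Rightarrow> nat \<Rightarrow> 'k::field"
  assumes "distinct xs" "length bs = length xs" "i \<in> set xs" "j \<in> set xs"
    and anti: "\<And>i j. i \<in> set xs \<Longrightarrow> j \<in> set xs \<Longrightarrow> \<mu> i j * \<mu> j i = 1 \<and> \<mu> i i = 1"
    and symm: "\<And>i j. i \<in> set xs \<Longrightarrow> j \<in> set xs \<Longrightarrow> b i j = \<mu> i j * b j i"
    and hom: "\<And>i j k. i \<in> set xs \<Longrightarrow> j \<in> set xs \<Longrightarrow> k \<in> set xs \<Longrightarrow> b j k \<noteq> 0 \<Longrightarrow> \<mu> i j * \<mu> i k = 1"
  shows "fock_op \<mu> b xs i (fock_op \<mu> b xs j f) bs + \<mu> i j * fock_op \<mu> b xs j (fock_op \<mu> b xs i f) bs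
    = 2 * b i j * f bs"
  using assms
proof (induction xs arbitrary: f bs i j)
  case Nil
  thus ?case by simp
next
  case (Cons p xs)
  obtain t cs where bs: "bs = t # cs" and cs: "length cs = length xs"
    using Cons.prems(2) by (cases bs) auto
  have *: "fock_op \<mu> b xs i (fock_op \<mu> b xs j h) cs + \<mu> i j * fock_op \<mu> b xs j (fock_op \<mu> b xs i h) cs
      = 2 * b i j * h cs" if "i \<in> set xs" "j \<in> set xs" for h
  proof (rule Cons.IH[OF _ cs that])
    show "distinct xs" using Cons.prems(1) by simp
  qed (meson Cons.prems(5-7) list.set_intros(2))+
  note anti = Cons.prems(5) and symm = Cons.prems(6) and hom = Cons.prems(7)
  have p: "p \<in> set (p # xs)" by simp
  have p_symm: "b q p = b p q" "b p q * \<mu> p q = b p q" if "q \<in> set (p # xs)" for q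
    by (metis symm[OF p that] symm[OF that p] hom[OF p p that] anti[OF p that] mult_1 mult_1_right
        mult_zero_left mult_zero_right)+
  have p_sq: "b p p * (\<mu> q p * \<mu> q p) = b p p" if "q \<in> set (p # xs)" for q
    using hom[OF that p p] by (cases "b p p = 0"; simp)
  have p_sq': "b p p * \<mu> q p = \<mu> p q * b p p" if "q \<in> set (p # xs)" for q
  proof -
    have "b p p * \<mu> q p = (\<mu> p q * \<mu> q p) * (b p p * \<mu> q p)"
      using anti[OF p that] by simp
    also have "\<dots> = \<mu> p q * (b p p * (\<mu> q p * \<mu> q p))"
      by (simp only: mult_ac)
    finally show ?thesis by (simp only: p_sq[OF that])
  qed
  note simps = fock_op_add fock_op_scale fock_op_uminus
  consider "i = p" "j = p" | "i = p" "j \<noteq> p" | "i \<noteq> p" "j = p" | "i \<noteq> p" "j \<noteq> p" by blast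
  thus ?case
  proof cases
    case 1
    thus ?thesis using anti[OF p p] by (cases t) (simp_all add: bs)
  next
    case 2
    note j = Cons.prems(4)
    show ?thesis
    proof (cases t)
      case True
      have "fock_op \<mu> b (p # xs) i (fock_op \<mu> b (p # xs) j f) bs +
          \<mu> i j * fock_op \<mu> b (p # xs) j (fock_op \<mu> b (p # xs) i f) bs =
          (1 - \<mu> p j * \<mu> j p) * fock_op \<mu> b xs j (\<lambda>cs. f (False # cs)) cs
            + 2 * b j p * f (True # cs)"
        using 2 by (simp add: True bs simps algebra_simps)
      thus ?thesis using 2 by (simp only: anti[OF p j] p_symm(1)[OF j] True bs) simp
    next
      case False
      have "fock_op \<mu> b (p # xs) i (fock_op \<mu> b (p # xs) j f) bs +
          \<mu> i j * fock_op \<mu> b (p # xs) j (fock_op \<mu> b (p # xs) i f) bs =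
          (\<mu> p j * b p p - b p p * \<mu> j p) * fock_op \<mu> b xs j (\<lambda>cs. f (True # cs)) cs
            + 2 * (b j p * \<mu> p j) * f (False # cs)"
        using 2 by (simp add: False bs simps algebra_simps)
      thus ?thesis using 2 by (simp only: p_symm[OF j] p_sq'[OF j] False bs) simp
    qed
  next
    case 3
    note i = Cons.prems(3)
    show ?thesis
    proof (cases t)
      case True
      have "fock_op \<mu> b (p # xs) i (fock_op \<mu> b (p # xs) j f) bs +
          \<mu> i j * fock_op \<mu> b (p # xs) j (fock_op \<mu> b (p # xs) i f) bs =
          2 * (\<mu> i p * b p i) * f (True # cs)"
        using 3 p_symm(1)[OF i] by (simp add: True bs simps algebra_simps)
      thus ?thesis using 3 by (simp only: True bs flip: symm[OF i p])
    next
      case False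
      have "fock_op \<mu> b (p # xs) i (fock_op \<mu> b (p # xs) j f) bs +
          \<mu> i j * fock_op \<mu> b (p # xs) j (fock_op \<mu> b (p # xs) i f) bs =
          (b p p - b p p * (\<mu> i p * \<mu> i p)) * fock_op \<mu> b xs i (\<lambda>cs. f (True # cs)) cs
            + 2 * b i p * f (False # cs)"
        using 3 by (simp add: False bs simps algebra_simps)
      thus ?thesis using 3 by (simp only: p_sq[OF i] False bs) simp
    qed
  next
    case 4
    hence ij: "i \<in> set xs" "j \<in> set xs" using Cons.prems(3,4) by auto
    note i = Cons.prems(3) and j = Cons.prems(4)
    let ?u = "\<lambda>cs. f (False # cs)" and ?v = "\<lambda>cs. f (True # cs)"
    let ?X = "fock_op \<mu> b xs"
    show ?thesis
    proof (cases t)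
      case True
      have "b i j * (\<mu> p i * \<mu> p j) = b i j"
        using hom[OF p i j] by (cases "b i j = 0"; simp)
      hence "\<mu> i p * \<mu> j p * b i j = \<mu> i p * \<mu> j p * (b i j * (\<mu> p i * \<mu> p j))"
        by (simp only:)
      also have "\<dots> = (\<mu> i p * \<mu> p i) * (\<mu> j p * \<mu> p j) * b i j"
        by (simp only: mult_ac)
      finally have h: "\<mu> i p * \<mu> j p * b i j = b i j"
        by (simp only: anti[OF i p] anti[OF j p] mult_1)
      have "fock_op \<mu> b (p # xs) i (fock_op \<mu> b (p # xs) j f) bs +
          \<mu> i j * fock_op \<mu> b (p # xs) j (fock_op \<mu> b (p # xs) i f) bs =
          \<mu> i p * \<mu> j p * (?X i (?X j ?v) cs + \<mu> i j * ?X j (?X i ?v) cs)"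
        using 4 by (simp add: True bs simps algebra_simps)
      also have "\<dots> = 2 * (\<mu> i p * \<mu> j p * b i j) * ?v cs"
        by (simp only: *[OF ij] mult_ac)
      finally show ?thesis by (simp only: h True bs)
    next
      case False
      have h1: "b j p * (\<mu> i j * \<mu> i p) = b j p"
        using hom[OF i j p] by (cases "b j p = 0"; simp)
      have "b i p * (\<mu> j i * \<mu> j p) = b i p"
        using hom[OF j i p] by (cases "b i p = 0"; simp)
      hence "\<mu> i j * b i p = \<mu> i j * (b i p * (\<mu> j i * \<mu> j p))"
        by (simp only:)
      also have "\<dots> = (\<mu> i j * \<mu> j i) * (b i p * \<mu> j p)"
        by (simp only: mult_ac)
      finally have h2: "\<mu> i j * b i p = b i p * \<mu> j p"
        by (simp only: anti[OF i j] mult_1)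
      have "fock_op \<mu> b (p # xs) i (fock_op \<mu> b (p # xs) j f) bs +
          \<mu> i j * fock_op \<mu> b (p # xs) j (fock_op \<mu> b (p # xs) i f) bs =
          (?X i (?X j ?u) cs + \<mu> i j * ?X j (?X i ?u) cs) +
          2 * (b j p - b j p * (\<mu> i j * \<mu> i p)) * ?X i ?v cs +
          2 * (\<mu> i j * b i p - b i p * \<mu> j p) * ?X j ?v cs"
        using 4 by (simp add: False bs simps algebra_simps)
      thus ?thesis by (simp only: h1 h2 *[OF ij] False bs) simp
    qed
  qed
qed

text \<open>
  The basis vector that encodes the empty monomial.
\<close>

definition vacuum :: "bool list \<Rightarrow> 'k::field" where
  "vacuum bs = (if True \<in> set bs then 0 else 1)"

text \<open>
  A monomial whose factors are in the order of the list creates exactly the basis vector that encodes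
  it: each factor precedes the generators already present, so no reordering takes place.
\<close>

lemma fock_op_vacuum:
  assumes "distinct xs" "ys \<in> set (subseqs xs)" "length bs = length xs"
  shows "foldr (fock_op \<mu> b xs) ys vacuum bs = (if map fst (filter snd (zip xs bs)) = ys then 1 else 0)"
  using assms
proof (induction xs arbitrary: ys bs)
  case Nil
  thus ?case by (simp add: vacuum_def)
next
  case (Cons p xs)
  have avoid: "(\<lambda>cs. foldr (fock_op \<mu> b (p # xs)) zs vacuum (True # cs)) = (\<lambda>_. 0) \<and>
      (\<lambda>cs. foldr (fock_op \<mu> b (p # xs)) zs vacuum (False # cs)) = foldr (fock_op \<mu> b xs) zs vacuum"
    if "p \<notin> set zs" for zs
    using that
    by (induction zs) (auto simp: vacuum_def fun_eq_iff fock_op_zero)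
  have sub: "zs \<in> set (subseqs xs) \<Longrightarrow> p \<notin> set zs" for zs
    using Cons.prems(1) subseqs_powset[of xs] by auto
  obtain t cs where bs: "bs = t # cs" and cs: "length cs = length xs"
    using Cons.prems(3) by (cases bs) auto
  have p: "p \<notin> set (map fst (filter snd (zip xs cs)))"
    using Cons.prems(1) by (auto dest: set_zip_leftD)
  hence p': "map fst (filter snd (zip xs cs)) \<noteq> p # zs" for zs
    by (metis list.set_intros(1))
  consider zs where "ys = p # zs" "zs \<in> set (subseqs xs)" | "ys \<in> set (subseqs xs)"
    using Cons.prems(2) by (auto simp: Let_def)
  thus ?case
  proof cases
    case (1 zs)
    show ?thesis
      using avoid[OF sub[OF 1(2)]] Cons.IH[OF _ 1(2) cs] Cons.prems(1) p'
      by (cases t) (auto simp: 1(1) bs fun_eq_iff simp del: map_eq_Cons_conv)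
  next
    case 2
    show ?thesis
      using avoid[OF sub[OF 2]] Cons.IH[OF _ 2 cs] Cons.prems(1) sub[OF 2]
      by (cases t) (auto simp: bs fun_eq_iff)
  qed
qed

lemma subseqs_mask:
  assumes "ys \<in> set (subseqs xs)"
  obtains bs where "length bs = length xs" "map fst (filter snd (zip xs bs)) = ys"
proof -
  have "\<exists>bs. length bs = length xs \<and> map fst (filter snd (zip xs bs)) = ys"
    using assms
  proof (induction xs arbitrary: ys)
    case Nil
    thus ?case by simp
  next
    case (Cons p xs)
    consider zs where "ys = p # zs" "zs \<in> set (subseqs xs)" | "ys \<in> set (subseqs xs)"
      using Cons.prems by (auto simp: Let_def)
    thus ?case
    proof cases
      case (1 zs)
      then obtain bs where "length bs = length xs" "map fst (filter snd (zip xs bs)) = zs"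
        using Cons.IH by blast
      thus ?thesis by (intro exI[of _ "True # bs"]) (simp add: 1)
    next
      case 2
      then obtain bs where "length bs = length xs" "map fst (filter snd (zip xs bs)) = ys"
        using Cons.IH by blast
      thus ?thesis by (intro exI[of _ "False # bs"]) simp
    qed
  qed
  thus ?thesis using that by blast
qed

section \<open>The defining ideal of a skew Clifford algebra\<close>

interpretation F: vector_space free_scale
  by (rule vector_space_free_scale)

text \<open>
  The set \<open>J\<close> is the kernel of the projection from the free algebra onto the skew Clifford algebra.
  Computing modulo \<open>J\<close> instead of in the quotient keeps all calculations inside an honest ring type.
  Minimality of \<open>J\<close> replaces the universal property of the quotient: a representation or an
  endomorphism that respects the relations respects \<open>J\<close>.
\<close>

locale skew_clifford_kernel = vector_space scale
  for scale :: "'k::field \<Rightarrow> 'v::ab_group_add \<Rightarrow> 'v" +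
  fixes n :: nat and x :: "nat \<Rightarrow> 'v" and \<mu> :: "nat \<Rightarrow> nat \<Rightarrow> 'k"
    and \<phi> :: "'v \<Rightarrow> 'v \<Rightarrow> 'k" and J :: "('v, 'k) free_alg set"
  assumes two_nonzero: "(2::'k) \<noteq> 0"
    and basis: "ordered_basis scale n x"
    and antisymmetric: "mult_antisymmetric n \<mu>"
    and symmetric: "mu_symmetric n x \<mu> \<phi>"
    and J_add: "p \<in> J \<Longrightarrow> q \<in> J \<Longrightarrow> p + q \<in> J"
    and J_left: "p \<in> J \<Longrightarrow> r * p \<in> J"
    and J_right: "p \<in> J \<Longrightarrow> p * r \<in> J"
    and J_tensor: "tensor_relations scale \<subseteq> J"
    and J_relation: "i \<in> {1..n} \<Longrightarrow> j \<in> {1..n} \<Longrightarrow>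
      free_gen (x i) * free_gen (x j) + free_scalar (\<mu> i j) * (free_gen (x j) * free_gen (x i))
        - free_scalar (2 * \<phi> (x i) (x j)) \<in> J"
    and J_least: "\<lbrakk>\<And>p q. p \<in> K \<Longrightarrow> q \<in> K \<Longrightarrow> p + q \<in> K; \<And>p r. p \<in> K \<Longrightarrow> r * p \<in> K;
        \<And>p r. p \<in> K \<Longrightarrow> p * r \<in> K; tensor_relations scale \<subseteq> K;
        \<And>i j. i \<in> {1..n} \<Longrightarrow> j \<in> {1..n} \<Longrightarrow>
          free_gen (x i) * free_gen (x j) + free_scalar (\<mu> i j) * (free_gen (x j) * free_gen (x i))
            - free_scalar (2 * \<phi> (x i) (x j)) \<in> K\<rbrakk> \<Longrightarrow> J \<subseteq> K"
    and J_proper: "1 \<notin> J"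
begin

abbreviation gen :: "nat \<Rightarrow> ('v, 'k) free_alg" where
  "gen i \<equiv> free_gen (x i)"

abbreviation b :: "nat \<Rightarrow> nat \<Rightarrow> 'k" where
  "b i j \<equiv> \<phi> (x i) (x j)"

abbreviation rel :: "nat \<Rightarrow> nat \<Rightarrow> ('v, 'k) free_alg" where
  "rel i j \<equiv> gen i * gen j + free_scalar (\<mu> i j) * (gen j * gen i) - free_scalar (2 * b i j)"

abbreviation mon :: "nat list \<Rightarrow> ('v, 'k) free_alg" where
  "mon ys \<equiv> prod_list (map gen ys)"

lemma mu_inverse: "i \<in> {1..n} \<Longrightarrow> j \<in> {1..n} \<Longrightarrow> \<mu> i j * \<mu> j i = 1"
  and mu_diag: "i \<in> {1..n} \<Longrightarrow> \<mu> i i = 1"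
  using antisymmetric by (auto simp: mult_antisymmetric_def)

lemma mu_nonzero: "i \<in> {1..n} \<Longrightarrow> j \<in> {1..n} \<Longrightarrow> \<mu> i j \<noteq> 0"
  using mu_inverse[of i j] by auto

lemma b_symm: "i \<in> {1..n} \<Longrightarrow> j \<in> {1..n} \<Longrightarrow> b i j = \<mu> i j * b j i"
  using symmetric unfolding mu_symmetric_def by blast

lemma J_zero: "0 \<in> J"
proof -
  have "free_gen (0 + 0) - free_gen 0 - free_gen 0 \<in> tensor_relations scale"
    unfolding tensor_relations_def by blast
  from J_left[OF subsetD[OF J_tensor this], of 0] show ?thesis by simp
qed

lemma J_subspace: "F.subspace J"
  by (rule F.subspaceI) (simp_all add: J_zero J_add J_left)

lemma J_uminus: "p \<in> J \<Longrightarrow> - p \<in> J"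
  using J_left[of p "-1"] by simp

lemma J_diff: "p \<in> J \<Longrightarrow> q \<in> J \<Longrightarrow> p - q \<in> J"
  using J_add[of p "- q"] by (simp add: J_uminus)

lemma J_scalar: "free_scalar c \<in> J \<Longrightarrow> c = 0"
proof (rule ccontr)
  assume "free_scalar c \<in> J" "c \<noteq> 0"
  hence "free_scalar (1 / c) * free_scalar c \<in> J" by (intro J_left)
  moreover have "free_scalar (1 / c) * free_scalar c = (1 :: ('v, 'k) free_alg)"
    using \<open>c \<noteq> 0\<close> by (subst free_scalar_mult[symmetric]) simp
  ultimately show False using J_proper by (simp only:)
qed

lemma J_cancel:
  assumes "c \<noteq> 0"
  shows "free_scalar c * p \<in> J \<longleftrightarrow> p \<in> J"
proof
  assume "free_scalar c * p \<in> J"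
  from J_left[OF this, of "free_scalar (1 / c)"] show "p \<in> J"
    using assms by simp
qed (rule J_left)

lemma J_cong: "p - q \<in> J \<Longrightarrow> p \<in> J \<longleftrightarrow> q \<in> J"
  using J_add[of "p - q" q] J_diff[of p "p - q"] by fastforce

lemma basis_independent: "independent (x ` {1..n})"
  and basis_span: "span (x ` {1..n}) = UNIV"
  and basis_inj: "inj_on x {1..n}"
  using basis by (auto simp: ordered_basis_def)

definition coord :: "'v \<Rightarrow> nat \<Rightarrow> 'k" where
  "coord v i = representation (x ` {1..n}) v (x i)"

lemma coord_add: "coord (v + w) i = coord v i + coord w i"
  unfolding coord_def by (subst representation_add[OF basis_independent]) (simp_all only: basis_span UNIV_I)

lemma coord_scale: "coord (scale c v) i = c * coord v i"
  unfolding coord_def by (subst representation_scale[OF basis_independent]) (simp_all only: basis_span UNIV_I)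

lemma coord_basis: "i \<in> {1..n} \<Longrightarrow> j \<in> {1..n} \<Longrightarrow> coord (x i) j = (if j = i then 1 else 0)"
  by (auto simp only: coord_def representation_basis[OF basis_independent imageI]
      inj_on_eq_iff[OF basis_inj])

definition lift_op :: "('k \<Rightarrow> 'm \<Rightarrow> 'm) \<Rightarrow> (nat \<Rightarrow> 'm \<Rightarrow> 'm) \<Rightarrow> 'v \<Rightarrow> 'm \<Rightarrow> 'm::ab_group_add" where
  "lift_op s T v y = (\<Sum>i\<in>{1..n}. s (coord v i) (T i y))"

lemma free_action_lift_op:
  assumes "vector_space s" "\<And>i. Vector_Spaces.linear s s (T i)"
  shows "free_action s (lift_op s T)"
proof -
  interpret M: vector_space s by fact
  have T: "T i (y + z) = T i y + T i z" "T i (s c y) = s c (T i y)" for i y z c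
    using assms(2)[of i] unfolding Vector_Spaces.linear_iff by blast+
  have "Vector_Spaces.linear s s (lift_op s T v)" for v
    unfolding Vector_Spaces.linear_iff
    by (simp add: assms(1) T lift_op_def M.scale_right_distrib sum.distrib M.scale_sum_right
        mult.commute)
  thus ?thesis
    by (intro free_action.intro free_action_axioms.intro assms(1))
qed

lemma lift_op_basis:
  assumes "vector_space s" "i \<in> {1..n}"
  shows "lift_op s T (x i) y = T i y"
proof -
  interpret M: vector_space s by fact
  have "lift_op s T (x i) y = (\<Sum>j\<in>{1..n}. if j = i then T j y else 0)"
    unfolding lift_op_def using assms(2) by (intro sum.cong) (auto simp: coord_basis)
  thus ?thesis using assms(2) by simp
qed

text \<open>
  The universal property, for operators assigned to the basis vectors only and with the relations
  satisfied modulo an invariant subspace.  Two instances are needed: the Fock representation, where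
  the subspace consists of the functions without meaningful values, and multiplication operators on
  the free algebra itself, where the subspace is \<open>J\<close>.
\<close>

lemma J_acts_into:
  assumes s: "vector_space s" and lin: "\<And>i. Vector_Spaces.linear s s (T i)"
    and N: "Modules.module.subspace s N" and inv: "\<And>i y. y \<in> N \<Longrightarrow> T i y \<in> N"
    and rels: "\<And>i j y. i \<in> {1..n} \<Longrightarrow> j \<in> {1..n} \<Longrightarrow>
        T i (T j y) + s (\<mu> i j) (T j (T i y)) - s (2 * b i j) y \<in> N"
    and p: "p \<in> J"
  shows "act s (lift_op s T) p y \<in> N"
proof -
  interpret M: free_action s "lift_op s T" by (rule free_action_lift_op[OF s lin])
  define K where "K = {p. \<forall>y. act s (lift_op s T) p y \<in> N}"
  have inv': "lift_op s T v y \<in> N" if "y \<in> N" for v y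
    unfolding lift_op_def by (intro M.subspace_sum M.subspace_scale N inv that)
  have "J \<subseteq> K"
  proof (rule J_least)
    show "tensor_relations scale \<subseteq> K"
      using M.subspace_0[OF N]
      by (auto simp: K_def tensor_relations_def M.act_diff_left M.act_mult lift_op_def coord_add
          coord_scale M.scale_left_distrib sum.distrib M.scale_sum_right)
  next
    fix i j assume "i \<in> {1..n}" "j \<in> {1..n}"
    thus "rel i j \<in> K"
      using rels by (simp add: K_def M.act_diff_left M.act_add_left M.act_mult lift_op_basis[OF s])
  next
    fix p r assume "p \<in> K"
    thus "r * p \<in> K"
      by (auto simp: K_def M.act_mult intro: M.act_invariant[OF N inv'])
  qed (auto simp: K_def M.act_add_left M.act_mult intro: M.subspace_add[OF N])
  thus ?thesis using p by (auto simp: K_def)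
qed

text \<open>
  If the assignment \<open>X\<^sub>m \<mapsto> c\<^sub>m X\<^bsub>r m\<^esub>\<close> is compatible with all the defining relations, then the Fock
  representation on the chosen generators \<open>xs\<close> extends to the whole algebra, and applying a
  combination of monomials to the vacuum reads off its coefficients.
\<close>

lemma fock_monomials_independent:
  assumes "distinct xs" "set xs \<subseteq> {1..n}"
    and hom: "\<And>i j k. i \<in> set xs \<Longrightarrow> j \<in> set xs \<Longrightarrow> k \<in> set xs \<Longrightarrow> b j k \<noteq> 0 \<Longrightarrow> \<mu> i j * \<mu> i k = 1"
    and r: "\<And>m. m \<in> {1..n} \<Longrightarrow> r m \<in> set xs"
    and fix_xs: "\<And>k. k \<in> set xs \<Longrightarrow> r k = k \<and> c k = 1"
    and same: "\<And>m j. m \<in> {1..n} \<Longrightarrow> j \<in> {1..n} \<Longrightarrow> r m = r j \<Longrightarrow>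
        c m * c j * b (r m) (r m) * (1 + \<mu> m j) = 2 * b m j"
    and diff: "\<And>m j. m \<in> {1..n} \<Longrightarrow> j \<in> {1..n} \<Longrightarrow> r m \<noteq> r j \<Longrightarrow>
        c m * c j * (\<mu> m j - \<mu> (r m) (r j)) = 0 \<and> c m * c j * b (r m) (r j) = b m j"
    and in_J: "(\<Sum>i<length (subseqs xs). free_scalar (a i) * mon (subseqs xs ! i)) \<in> J"
    and i: "i < length (subseqs xs)"
  shows "a i = 0"
proof -
  define T where "T m f = fun_scale (c m) (fock_op \<mu> b xs (r m) f)" for m f
  define N where "N = {f :: bool list \<Rightarrow> 'k. \<forall>bs. length bs = length xs \<longrightarrow> f bs = 0}"
  have lin: "Vector_Spaces.linear fun_scale fun_scale (T m)" for m
    by (simp add: Vector_Spaces.linear_iff vector_space_fun_scale T_def fun_eq_iff fock_op_scale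
      fock_op_add plus_fun_def algebra_simps)
  have N: "Modules.module.subspace fun_scale N"
  proof -
    interpret M: vector_space "fun_scale :: 'k \<Rightarrow> (bool list \<Rightarrow> 'k) \<Rightarrow> _"
      by (rule vector_space_fun_scale)
    show ?thesis by (rule M.subspaceI) (auto simp: N_def)
  qed
  have inv: "T m f \<in> N" if "f \<in> N" for m f
    using that fock_op_cong[of xs f "\<lambda>_. 0"] by (auto simp: N_def T_def fock_op_zero)
  have sub: "k \<in> {1..n}" if "k \<in> set xs" for k using assms(2) that by auto
  have rels: "T m (T j f) + fun_scale (\<mu> m j) (T j (T m f)) - fun_scale (2 * b m j) f \<in> N"
    if mj: "m \<in> {1..n}" "j \<in> {1..n}" for m j f
  proof -
    have "T m (T j f) bs + \<mu> m j * T j (T m f) bs - 2 * b m j * f bs = 0"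
      if bs: "length bs = length xs" for bs
    proof -
      let ?A = "fock_op \<mu> b xs (r m) (fock_op \<mu> b xs (r j) f) bs"
      let ?B = "fock_op \<mu> b xs (r j) (fock_op \<mu> b xs (r m) f) bs"
      have *: "?A + \<mu> (r m) (r j) * ?B = 2 * b (r m) (r j) * f bs"
        by (rule fock_op_relation[OF assms(1) bs r[OF mj(1)] r[OF mj(2)] _ _ hom])
          (blast intro: mu_inverse mu_diag b_symm sub)+
      have "T m (T j f) bs + \<mu> m j * T j (T m f) bs = c m * c j * (?A + \<mu> m j * ?B)"
        by (simp add: T_def fock_op_scale algebra_simps)
      also have "\<dots> = 2 * b m j * f bs"
      proof (cases "r m = r j")
        case True
        have "2 * ?A = 2 * (b (r m) (r m) * f bs)"
          using * mu_diag[OF sub[OF r[OF mj(1)]]] True by simp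
        hence A: "?A = b (r m) (r m) * f bs" using two_nonzero by (simp only: mult_cancel_left) simp
        have "c m * c j * (?A + \<mu> m j * ?B) = c m * c j * (1 + \<mu> m j) * ?A"
          using True by (simp add: algebra_simps)
        also have "\<dots> = (c m * c j * b (r m) (r m) * (1 + \<mu> m j)) * f bs"
          unfolding A by (simp only: mult_ac)
        finally show ?thesis unfolding same[OF mj True] .
      next
        case False
        have "c m * c j * (?A + \<mu> m j * ?B) =
            c m * c j * (?A + \<mu> (r m) (r j) * ?B) + c m * c j * (\<mu> m j - \<mu> (r m) (r j)) * ?B"
          by (simp add: algebra_simps)
        also have "\<dots> = 2 * (c m * c j * b (r m) (r j)) * f bs"
          unfolding * conjunct1[OF diff[OF mj False]]
          by (simp only: mult_zero_left add_0_right mult_ac)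
        finally show ?thesis unfolding conjunct2[OF diff[OF mj False]] .
      qed
      finally show ?thesis by simp
    qed
    thus ?thesis by (simp add: N_def)
  qed
  let ?act = "act fun_scale (lift_op fun_scale T)"
  interpret A: free_action fun_scale "lift_op fun_scale T"
    by (rule free_action_lift_op[OF vector_space_fun_scale lin])
  have T_xs: "T y f = fock_op \<mu> b xs y f" if "y \<in> set xs" for y f
    using fix_xs[OF that] by (simp add: T_def)
  have mon: "?act (mon ys) vacuum = foldr (fock_op \<mu> b xs) ys vacuum" if "set ys \<subseteq> set xs" for ys
    using that
  proof (induction ys)
    case (Cons y ys)
    thus ?case
      using sub[of y] by (simp add: A.act_mult lift_op_basis[OF vector_space_fun_scale] T_xs)
  qed simp
  let ?ys = "\<lambda>i. subseqs xs ! i"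
  have ys: "set (?ys i) \<subseteq> set xs" if "i < length (subseqs xs)" for i
    using subseqs_powset[of xs] nth_mem[OF that] by auto
  obtain bs where bs: "length bs = length xs" "map fst (filter snd (zip xs bs)) = ?ys i"
    using subseqs_mask[OF nth_mem[OF i]] by blast
  have "?act (\<Sum>i<length (subseqs xs). free_scalar (a i) * mon (?ys i)) vacuum \<in> N"
    by (rule J_acts_into[OF vector_space_fun_scale lin N inv rels in_J])
  hence "0 = ?act (\<Sum>i<length (subseqs xs). free_scalar (a i) * mon (?ys i)) vacuum bs"
    using bs(1) by (simp add: N_def)
  also have "\<dots> = (\<Sum>j<length (subseqs xs). a j * foldr (fock_op \<mu> b xs) (?ys j) vacuum bs)"
    using mon[OF ys] by (simp add: A.act_sum_left A.act_mult sum_fun_apply)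
  also have "\<dots> = (\<Sum>j<length (subseqs xs). if j = i then a j else 0)"
  proof (rule sum.cong)
    fix j assume j: "j \<in> {..<length (subseqs xs)}"
    have "distinct (subseqs xs)"
      using distinct_set_subseqs[OF assms(1)] by (simp add: distinct_map)
    hence "?ys i = ?ys j \<longleftrightarrow> j = i" using i j by (simp add: nth_eq_iff_index_eq eq_commute)
    thus "a j * foldr (fock_op \<mu> b xs) (?ys j) vacuum bs = (if j = i then a j else 0)"
      using fock_op_vacuum[OF assms(1) nth_mem bs(1), of j \<mu> b] j bs(2) by simp
  qed simp
  also have "\<dots> = a i" using i by simp
  finally show ?thesis by simp
qed

section \<open>Linear relations between generators\<close>

lemma gen_scalar: "gen i * (free_scalar c * p) = free_scalar c * (gen i * p)"
  and gen_scalar': "gen i * free_scalar c = free_scalar c * gen i"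
  by (rule free_scalar_left_commute free_scalar_commute)+

lemmas normalize = distrib_left distrib_right left_diff_distrib right_diff_distrib mult.assoc
  gen_scalar gen_scalar'

lemma free_scalar_two: "free_scalar 2 * p = p + p"
proof -
  have "free_scalar (1 + 1) * p = p + p"
    by (simp only: free_scalar_add free_scalar_1 distrib_right mult_1)
  thus ?thesis by simp
qed

lemma rel_in_J: "i \<in> {1..n} \<Longrightarrow> j \<in> {1..n} \<Longrightarrow> rel i j \<in> J"
  by (rule J_relation)

lemma square_in_J:
  assumes "i \<in> {1..n}"
  shows "gen i * gen i - free_scalar (b i i) \<in> J"
proof -
  have "rel i i = free_scalar 2 * (gen i * gen i - free_scalar (b i i))"
    by (simp only: mu_diag[OF assms] free_scalar_1 mult_1 mult_2 free_scalar_two free_scalar_add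
        diff_diff_eq add_diff_eq diff_add_eq)
  hence "free_scalar 2 * (gen i * gen i - free_scalar (b i i)) \<in> J"
    using rel_in_J[OF assms assms] by (simp only:)
  thus ?thesis by (simp only: J_cancel[OF two_nonzero])
qed

text \<open>
  The two ways of moving \<open>X\<^sub>k\<close> to the front and \<open>X\<^sub>i\<close> to the back of \<open>X\<^sub>i X\<^sub>j X\<^sub>k\<close> differ by a linear
  combination of generators.  The indices may coincide; the case \<open>i = j\<close> is the relation obtained from
  \<open>X\<^sub>i X\<^sub>i X\<^sub>k\<close>.
\<close>

lemma overlap_in_J:
  assumes "i \<in> {1..n}" "j \<in> {1..n}" "k \<in> {1..n}"
  shows "free_scalar (b j k * (\<mu> i j * \<mu> i k - 1)) * gen i
      + free_scalar (b i k * (\<mu> j k - \<mu> i j)) * gen j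
      + free_scalar (b i j * (1 - \<mu> j k * \<mu> i k)) * gen k \<in> J" (is "?L \<in> J")
proof -
  \<comment> \<open>Both \<open>?P\<close> and \<open>?Q\<close> equal \<open>X\<^sub>i X\<^sub>j X\<^sub>k\<close> plus the same multiple of \<open>X\<^sub>k X\<^sub>j X\<^sub>i\<close> plus linear terms.\<close>
  let ?P = "rel i j * gen k - free_scalar (\<mu> i j) * (gen j * rel i k)
    + free_scalar (\<mu> i j * \<mu> i k) * (rel j k * gen i)"
  let ?Q = "gen i * rel j k - free_scalar (\<mu> j k) * (rel i k * gen j)
    + free_scalar (\<mu> j k * \<mu> i k) * (gen k * rel i j)"
  have "?Q - ?P \<in> J"
    using rel_in_J[OF assms(1,2)] rel_in_J[OF assms(1,3)] rel_in_J[OF assms(2,3)]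
    by (simp only: J_diff J_add J_left J_right)
  also have "?Q - ?P = free_scalar 2 * ?L"
    by (simp only: normalize F.scale_scale, simp only: ring_distribs mult_ac,
        simp only: free_scalar_diff ring_distribs, simp add: algebra_simps)
  finally show ?thesis by (simp only: J_cancel[OF two_nonzero])
qed

lemma b_zero_of_gen_in_J:
  assumes "i \<in> {1..n}" "j \<in> {1..n}" "gen i \<in> J"
  shows "b i j = 0" "b j i = 0"
proof -
  have "(gen i * gen j + free_scalar (\<mu> i j) * (gen j * gen i)) - rel i j \<in> J"
    using assms(3) rel_in_J[OF assms(1,2)] by (simp only: J_diff J_add J_left J_right)
  hence "free_scalar (2 * b i j) \<in> J" by simp
  from J_scalar[OF this] show "b i j = 0" using two_nonzero by simp
  thus "b j i = 0" using b_symm[OF assms(2,1)] by simp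
qed

definition independent_mod :: "nat \<Rightarrow> nat \<Rightarrow> bool" where
  "independent_mod k l \<longleftrightarrow>
     (\<forall>\<alpha> \<beta>. free_scalar \<alpha> * gen k + free_scalar \<beta> * gen l \<in> J \<longrightarrow> \<alpha> = 0 \<and> \<beta> = 0)"

text \<open>
  Distinct leading generators are not proportional, and every nonzero generator is a multiple of a leading
  one.  Choosing the first member of each class makes the choice canonical.
\<close>

definition leading :: "nat set" where
  "leading = {m \<in> {1..n}. gen m \<notin> J \<and> (\<forall>k\<in>{1..<m}. \<forall>c. gen m - free_scalar c * gen k \<notin> J)}"

lemma leading_range: "k \<in> leading \<Longrightarrow> k \<in> {1..n}"
  and leading_not_in_J: "k \<in> leading \<Longrightarrow> gen k \<notin> J"
  by (auto simp: leading_def)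

lemma leading_independent:
  assumes "k \<in> leading" "l \<in> leading" "k \<noteq> l"
  shows "independent_mod k l"
proof -
  have *: "\<alpha> = 0 \<and> \<beta> = 0"
    if "k \<in> leading" "l \<in> leading" "k < l"
      and J: "free_scalar \<alpha> * gen k + free_scalar \<beta> * gen l \<in> J" for k l \<alpha> \<beta>
  proof -
    have "\<beta> = 0"
    proof (rule ccontr)
      assume "\<beta> \<noteq> 0"
      have "free_scalar (1 / \<beta>) * (free_scalar \<alpha> * gen k + free_scalar \<beta> * gen l) \<in> J"
        by (rule J_left[OF J])
      hence "gen l - free_scalar (- \<alpha> / \<beta>) * gen k \<in> J"
        using \<open>\<beta> \<noteq> 0\<close> by (simp add: distrib_left free_scalar_uminus add.commute)
      moreover have "k \<in> {1..<l}" using that(3) leading_range[OF that(1)] by simp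
      ultimately show False using that(2) unfolding leading_def by blast
    qed
    thus ?thesis using J leading_not_in_J[OF that(1)] J_cancel[of \<alpha>] by auto
  qed
  show ?thesis
    unfolding independent_mod_def
    using *[of k l] *[of l k] assms by (metis add.commute nat_neq_iff)
qed

lemma leading_represents:
  assumes "m \<in> {1..n}" "gen m \<notin> J"
  shows "\<exists>k\<in>leading. \<exists>c. c \<noteq> 0 \<and> gen m - free_scalar c * gen k \<in> J"
  using assms
proof (induction m rule: less_induct)
  case (less m)
  show ?case
  proof (cases "m \<in> leading")
    case True
    thus ?thesis using J_zero by (intro bexI[of _ m] exI[of _ 1]) simp_all
  next
    case False
    then obtain k c where k: "k \<in> {1..<m}" and c: "gen m - free_scalar c * gen k \<in> J"
      using less.prems by (auto simp: leading_def)
    have "c \<noteq> 0" using c less.prems(2) by auto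
    moreover have "gen k \<notin> J"
      using less.prems(2) J_cong[OF c] J_left[of "gen k" "free_scalar c"] by auto
    ultimately obtain l d where l: "l \<in> leading" "d \<noteq> 0" "gen k - free_scalar d * gen l \<in> J"
      using less.IH[of k] k less.prems(1) by auto
    have "(gen m - free_scalar c * gen k) + free_scalar c * (gen k - free_scalar d * gen l) \<in> J"
      by (intro J_add J_left c l)
    hence "gen m - free_scalar (c * d) * gen l \<in> J"
      by (simp add: right_diff_distrib)
    thus ?thesis using \<open>c \<noteq> 0\<close> l by (intro bexI[of _ l] exI[of _ "c * d"]) auto
  qed
qed

lemma leading_pair:
  assumes "i \<in> leading" "k \<in> leading" "i \<noteq> k"
  shows "b i k \<noteq> 0 \<Longrightarrow> \<mu> i k = 1" "b i i \<noteq> 0 \<Longrightarrow> \<mu> i k * \<mu> i k = 1"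
proof -
  note r = leading_range[OF assms(1)] leading_range[OF assms(2)]
  have "free_scalar (2 * b i k * (\<mu> i k - 1)) * gen i
      + free_scalar (b i i * (1 - \<mu> i k * \<mu> i k)) * gen k \<in> J"
    using overlap_in_J[OF r(1) r(1) r(2)]
    by (simp only: mu_diag[OF r(1)] mult_1 mult_2 distrib_right free_scalar_add)
  hence *: "2 * b i k * (\<mu> i k - 1) = 0" "b i i * (1 - \<mu> i k * \<mu> i k) = 0"
    using leading_independent[OF assms] unfolding independent_mod_def by blast+
  show "b i k \<noteq> 0 \<Longrightarrow> \<mu> i k = 1" using *(1) two_nonzero by simp
  show "b i i \<noteq> 0 \<Longrightarrow> \<mu> i k * \<mu> i k = 1" using *(2) by simp
qed

text \<open>
  Among leading generators all overlap relations are trivial.  A relation in at most two of them has zero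
  coefficients, and a relation with three nonzero terms would need three nonzero values of the form,
  which by \<open>leading_pair\<close> makes the parameters equal to \<open>1\<close> and the coefficients vanish anyway.
\<close>

lemma leading_homogeneous:
  assumes i: "i \<in> leading" and j: "j \<in> leading" and k: "k \<in> leading" and b: "b j k \<noteq> 0"
  shows "\<mu> i j * \<mu> i k = 1"
proof -
  note r = leading_range[OF i] leading_range[OF j] leading_range[OF k]
  note ind = leading_independent[unfolded independent_mod_def, rule_format]
  consider "i = j" "i = k" | "i \<noteq> j" "j = k" | "i = j" "i \<noteq> k" | "i = k" "i \<noteq> j"
    | "i \<noteq> j" "i \<noteq> k" "j \<noteq> k" by blast
  thus ?thesis
  proof cases
    case 1
    thus ?thesis using mu_diag[OF r(1)] by simp
  next
    case 2
    have "\<mu> j i * \<mu> j i = 1" using leading_pair(2)[OF j i] 2 b by auto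
    hence "\<mu> i j * \<mu> i j = (\<mu> i j * \<mu> i j) * (\<mu> j i * \<mu> j i)"
      by (simp only: mult_1_right)
    also have "\<dots> = (\<mu> i j * \<mu> j i) * (\<mu> i j * \<mu> j i)"
      by (simp only: mult_ac)
    also have "\<dots> = 1"
      by (simp only: mu_inverse[OF r(1,2)] mult_1)
    finally show ?thesis using 2 by simp
  next
    case 3
    thus ?thesis using leading_pair(1)[OF i k] b mu_diag[OF r(1)] by simp
  next
    case 4
    hence "\<mu> j k = 1" using leading_pair(1)[OF j k] b by auto
    thus ?thesis using 4 mu_inverse[OF r(3) r(2)] mu_diag[OF r(1)] by simp
  next
    case 5
    note J = overlap_in_J[OF r]
    consider "b i k = 0" | "b i j = 0" | "b i k \<noteq> 0" "b i j \<noteq> 0" by blast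
    thus ?thesis
    proof cases
      case 1
      with J have "free_scalar (b j k * (\<mu> i j * \<mu> i k - 1)) * gen i
          + free_scalar (b i j * (1 - \<mu> j k * \<mu> i k)) * gen k \<in> J"
        by (simp only: mult_zero_left free_scalar_0 add_0_right)
      hence "b j k * (\<mu> i j * \<mu> i k - 1) = 0" using ind[OF i k 5(2)] by blast
      thus ?thesis using b by simp
    next
      case 2
      with J have "free_scalar (b j k * (\<mu> i j * \<mu> i k - 1)) * gen i
          + free_scalar (b i k * (\<mu> j k - \<mu> i j)) * gen j \<in> J"
        by (simp only: mult_zero_left free_scalar_0 add_0_right)
      hence "b j k * (\<mu> i j * \<mu> i k - 1) = 0" using ind[OF i j 5(1)] by blast
      thus ?thesis using b by simp
    next
      case 3
      thus ?thesis using leading_pair(1)[OF i k] leading_pair(1)[OF i j] 5 by simp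
    qed
  qed
qed

text \<open>
  Moving \<open>X\<^sub>p\<close> to the front in \<open>0 = X\<^sub>l X\<^sub>q X\<^sub>p\<close> leaves the linear relation
  \<open>2 b\<^sub>q\<^sub>p X\<^sub>l = 2 \<mu>\<^sub>q\<^sub>p b\<^sub>l\<^sub>p X\<^sub>q\<close>.
\<close>

lemma zero_product_isotropic:
  assumes "l \<in> {1..n}" "q \<in> {1..n}" "p \<in> {1..n}"
    and prod: "gen l * gen q \<in> J" and ind: "independent_mod l q"
  shows "b q p = 0" "b l p = 0"
proof -
  have "(gen l * gen q) * gen p - gen l * rel q p + free_scalar (\<mu> q p) * (rel l p * gen q)
      - free_scalar (\<mu> q p * \<mu> l p) * (gen p * (gen l * gen q)) \<in> J"
    using prod rel_in_J[OF assms(2,3)] rel_in_J[OF assms(1,3)]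
    by (simp only: J_diff J_add J_left J_right)
  also have "(gen l * gen q) * gen p - gen l * rel q p + free_scalar (\<mu> q p) * (rel l p * gen q)
      - free_scalar (\<mu> q p * \<mu> l p) * (gen p * (gen l * gen q)) =
      free_scalar (2 * b q p) * gen l + free_scalar (- (\<mu> q p * (2 * b l p))) * gen q"
    by (simp add: normalize free_scalar_uminus)
  finally have "2 * b q p = 0 \<and> - (\<mu> q p * (2 * b l p)) = 0"
    using ind unfolding independent_mod_def by blast
  thus "b q p = 0" "b l p = 0" using two_nonzero mu_nonzero[OF assms(2,3)] by simp_all
qed

text \<open>
  If \<open>x\<^sub>m\<close> lies in the radical, then \<open>X\<^sub>m \<mapsto> - X\<^sub>m\<close> respects the relations, so a relation
  \<open>X\<^sub>m = c X\<^sub>k\<close> implies \<open>- X\<^sub>m = c X\<^sub>k\<close>.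
\<close>

lemma isotropic_not_proportional:
  assumes m: "m \<in> {1..n}" and k: "k \<in> {1..n}" "k \<noteq> m"
    and iso: "\<And>p. p \<in> {1..n} \<Longrightarrow> b m p = 0"
    and dep: "gen m - free_scalar c * gen k \<in> J"
  shows "gen m \<in> J"
proof -
  define \<sigma> :: "nat \<Rightarrow> 'k" where "\<sigma> i = (if i = m then - 1 else 1)" for i
  \<comment> \<open>Left multiplication by the image of \<open>X\<^sub>i\<close> under the sign change; applied to \<open>1\<close> it gives the automorphism.\<close>
  define T where "T i p = free_scalar (\<sigma> i) * (gen i * p)" for i p
  have lin: "Vector_Spaces.linear free_scale free_scale (T i)" for i
    unfolding Vector_Spaces.linear_iff
    by (simp add: vector_space_free_scale T_def distrib_left gen_scalar mult.commute)
  have rels: "T i (T j p) + free_scalar (\<mu> i j) * T j (T i p) - free_scalar (2 * b i j) * p \<in> J"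
    if ij: "i \<in> {1..n}" "j \<in> {1..n}" for i j p
  proof -
    have "\<sigma> i * \<sigma> j * b i j = b i j"
    proof (cases "i = m \<or> j = m")
      case True
      hence "b i j = 0" using iso ij b_symm[OF ij] by auto
      thus ?thesis by simp
    qed (simp add: \<sigma>_def)
    hence *: "free_scalar (2 * b i j) * p = free_scalar (\<sigma> i * \<sigma> j * (2 * b i j)) * p"
      by (simp add: mult.left_commute)
    have "T i (T j p) + free_scalar (\<mu> i j) * T j (T i p) - free_scalar (2 * b i j) * p =
        free_scalar (\<sigma> i * \<sigma> j) * (rel i j * p)"
      unfolding * by (simp add: T_def normalize mult_ac)
    thus ?thesis by (simp only: J_left J_right rel_in_J[OF ij])
  qed
  interpret S: free_action free_scale "lift_op free_scale T"
    by (rule free_action_lift_op[OF vector_space_free_scale lin])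
  have "act free_scale (lift_op free_scale T) (gen m - free_scalar c * gen k) 1 \<in> J"
    by (rule J_acts_into[OF vector_space_free_scale lin J_subspace _ rels dep])
      (simp add: T_def J_left)
  hence "- gen m - free_scalar c * gen k \<in> J"
    using m k by (simp add: S.act_diff_left S.act_mult lift_op_basis[OF vector_space_free_scale]
      T_def \<sigma>_def free_scalar_uminus)
  from J_diff[OF dep this] have "free_scalar 2 * gen m \<in> J"
    by (simp add: free_scalar_two)
  thus ?thesis by (simp only: J_cancel[OF two_nonzero])
qed

section \<open>A basis of monomials in the leading generators\<close>

text \<open>
  The relation between two generators follows from the one between their leading representatives.
  The only danger is that comparing them makes \<open>X\<^sub>l X\<^sub>k\<close> equal to a scalar.
\<close>

lemma reduction_compatible:
  assumes m: "m \<in> {1..n}" and j: "j \<in> {1..n}" and k: "k \<in> leading" and l: "l \<in> leading"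
    and c: "c \<noteq> 0" and d: "d \<noteq> 0"
    and mk: "gen m - free_scalar c * gen k \<in> J" and jl: "gen j - free_scalar d * gen l \<in> J"
  shows "k = l \<Longrightarrow> c * d * b k k * (1 + \<mu> m j) = 2 * b m j"
    and "k \<noteq> l \<Longrightarrow> c * d * (\<mu> m j - \<mu> k l) = 0 \<and> c * d * b k l = b m j"
proof -
  note kr = leading_range[OF k] and lr = leading_range[OF l]
  have prod: "gen m' * gen j' - free_scalar (c' * d') * (gen k' * gen l') \<in> J"
    if "gen m' - free_scalar c' * gen k' \<in> J" "gen j' - free_scalar d' * gen l' \<in> J"
    for m' j' k' l' c' d'
  proof -
    have "(gen m' - free_scalar c' * gen k') * gen j'
        + free_scalar c' * (gen k' * (gen j' - free_scalar d' * gen l')) \<in> J"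
      using that by (simp only: J_add J_left J_right)
    thus ?thesis by (simp add: normalize)
  qed
  have "rel m j - (gen m * gen j - free_scalar (c * d) * (gen k * gen l))
      - free_scalar (\<mu> m j) * (gen j * gen m - free_scalar (d * c) * (gen l * gen k)) \<in> J"
    using rel_in_J[OF m j] prod[OF mk jl] prod[OF jl mk] by (simp only: J_diff J_left)
  hence E: "free_scalar (c * d) * (gen k * gen l) + free_scalar (\<mu> m j * (d * c)) * (gen l * gen k)
      - free_scalar (2 * b m j) \<in> J"
    by (simp add: normalize algebra_simps)
  show "c * d * b k k * (1 + \<mu> m j) = 2 * b m j" if "k = l"
  proof -
    let ?t = "c * d + \<mu> m j * (d * c)"
    have "free_scalar (c * d) * (gen k * gen k) + free_scalar (\<mu> m j * (d * c)) * (gen k * gen k)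
        - free_scalar (2 * b m j) - free_scalar ?t * (gen k * gen k - free_scalar (b k k)) \<in> J"
      using E square_in_J[OF kr] that by (simp only: J_diff J_left)
    also have "free_scalar (c * d) * (gen k * gen k) + free_scalar (\<mu> m j * (d * c)) * (gen k * gen k)
        - free_scalar (2 * b m j) - free_scalar ?t * (gen k * gen k - free_scalar (b k k)) =
        free_scalar ?t * free_scalar (b k k) - free_scalar (2 * b m j)"
      by (simp only: free_scalar_add[of "c * d"] ring_distribs) simp
    also have "\<dots> = free_scalar (?t * b k k - 2 * b m j)"
      by (simp only: free_scalar_mult free_scalar_diff)
    finally show ?thesis using J_scalar by (fastforce simp: algebra_simps)
  qed
  show "c * d * (\<mu> m j - \<mu> k l) = 0 \<and> c * d * b k l = b m j" if neq: "k \<noteq> l"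
  proof -
    define t where "t = c * d * (\<mu> m j - \<mu> k l)"
    define s where "s = 2 * b m j - c * d * (2 * b k l)"
    have "free_scalar (c * d) * (gen k * gen l) + free_scalar (\<mu> m j * (d * c)) * (gen l * gen k)
        - free_scalar (2 * b m j) - free_scalar (c * d) * rel k l \<in> J"
      using E rel_in_J[OF kr lr] by (simp only: J_diff J_left)
    also have "free_scalar (c * d) * (gen k * gen l) + free_scalar (\<mu> m j * (d * c)) * (gen l * gen k)
        - free_scalar (2 * b m j) - free_scalar (c * d) * rel k l =
        free_scalar t * (gen l * gen k) - free_scalar s"
    proof -
      have "t = \<mu> m j * (d * c) - c * d * \<mu> k l" by (simp add: t_def algebra_simps)
      moreover have "free_scalar (c * d) * free_scalar (2 * b k l) =
          (free_scalar (c * d * (2 * b k l)) :: ('v, 'k) free_alg)"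
        by (rule free_scalar_mult[symmetric])
      ultimately show ?thesis
        unfolding s_def by (simp only: free_scalar_diff ring_distribs F.scale_scale) simp
    qed
    finally have ts: "free_scalar t * (gen l * gen k) - free_scalar s \<in> J" .
    have "t = 0"
    proof (rule ccontr)
      assume t: "t \<noteq> 0"
      \<comment> \<open>Evaluating \<open>X\<^sub>l X\<^sub>l X\<^sub>k\<close> with \<open>t X\<^sub>l X\<^sub>k = s\<close> shows \<open>s X\<^sub>l = t b\<^sub>l\<^sub>l X\<^sub>k\<close>, hence \<open>s = 0\<close>.\<close>
      have "gen l * (free_scalar t * (gen l * gen k) - free_scalar s)
          - free_scalar t * ((gen l * gen l - free_scalar (b l l)) * gen k) \<in> J"
        using ts square_in_J[OF lr] by (simp only: J_diff J_left J_right)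
      hence "free_scalar (- s) * gen l + free_scalar (t * b l l) * gen k \<in> J"
        by (simp add: normalize free_scalar_uminus)
      hence "s = 0"
        using leading_independent[OF l k] neq unfolding independent_mod_def by fastforce
      hence lk: "gen l * gen k \<in> J" using ts J_cancel[OF t] by simp
      have "(gen j - free_scalar d * gen l) * gen k + free_scalar d * (gen l * gen k) \<in> J"
        using jl lk by (simp only: J_add J_left J_right)
      hence jk: "gen j * gen k \<in> J" by (simp add: normalize)
      have "gen l * (gen m - free_scalar c * gen k) + free_scalar c * (gen l * gen k) \<in> J"
        using mk lk by (simp only: J_add J_left J_right)
      hence lm: "gen l * gen m \<in> J" by (simp add: normalize)
      have ind_lm: "independent_mod l m"
        unfolding independent_mod_def
      proof (intro allI impI)
        fix \<alpha> \<beta> assume "free_scalar \<alpha> * gen l + free_scalar \<beta> * gen m \<in> J"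
        from J_diff[OF this J_left[OF mk, of "free_scalar \<beta>"]]
        have "free_scalar \<alpha> * gen l + free_scalar (\<beta> * c) * gen k \<in> J"
          by (simp add: normalize)
        hence "\<alpha> = 0 \<and> \<beta> * c = 0"
          using leading_independent[OF l k] neq unfolding independent_mod_def by blast
        thus "\<alpha> = 0 \<and> \<beta> = 0" using c by simp
      qed
      have ind_jk: "independent_mod j k"
        unfolding independent_mod_def
      proof (intro allI impI)
        fix \<alpha> \<beta> assume "free_scalar \<alpha> * gen j + free_scalar \<beta> * gen k \<in> J"
        from J_diff[OF this J_left[OF jl, of "free_scalar \<alpha>"]]
        have "free_scalar (\<alpha> * d) * gen l + free_scalar \<beta> * gen k \<in> J"
          by (simp add: normalize add.commute)
        hence "\<alpha> * d = 0 \<and> \<beta> = 0"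
          using leading_independent[OF l k] neq unfolding independent_mod_def by blast
        thus "\<alpha> = 0 \<and> \<beta> = 0" using d by simp
      qed
      \<comment> \<open>All vectors involved are in the radical, so proportional generators must coincide, and then \<open>t = 0\<close>.\<close>
      have "gen m \<notin> J"
        using leading_not_in_J[OF k] J_cong[OF mk] J_cancel[OF c] by simp
      hence "m = k"
        using isotropic_not_proportional[OF m kr _ zero_product_isotropic(1)[OF lr m _ lm ind_lm] mk]
        by blast
      have "gen j \<notin> J"
        using leading_not_in_J[OF l] J_cong[OF jl] J_cancel[OF d] by simp
      hence "j = l"
        using isotropic_not_proportional[OF j lr _ zero_product_isotropic(2)[OF j kr _ jk ind_jk] jl]
        by blast
      show False using t \<open>m = k\<close> \<open>j = l\<close> by (simp add: t_def)
    qed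
    hence "free_scalar (- s) \<in> J" using ts by (simp add: free_scalar_uminus)
    hence "s = 0" using J_scalar by fastforce
    hence "2 * b m j = 2 * (c * d * b k l)" unfolding s_def by (simp only: right_minus_eq mult_ac)
    hence "b m j = c * d * b k l" using mult_left_cancel[OF two_nonzero] by blast
    thus ?thesis using \<open>t = 0\<close> by (simp add: t_def)
  qed
qed

text \<open>
  If all generators vanished, the form would be zero.  Sending \<open>X\<^sub>1\<close> to the creation operator of a
  single generator and all the others to \<open>0\<close> is then compatible with the relations, although it does
  not kill \<open>X\<^sub>1\<close>.
\<close>

lemma some_generator_survives:
  assumes "n \<ge> 1"
  shows "leading \<noteq> {}"
proof
  assume "leading = {}"
  hence all: "gen m \<in> J" if "m \<in> {1..n}" for m
    using leading_represents[OF that] by blast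
  have b: "b i j = 0" if "i \<in> {1..n}" "j \<in> {1..n}" for i j
    by (rule b_zero_of_gen_in_J[OF that all[OF that(1)]])
  define c :: "nat \<Rightarrow> 'k" where "c m = (if m = 1 then 1 else 0)" for m
  \<comment> \<open>The coefficients of \<open>X\<^sub>1\<close> with respect to the monomials \<open>X\<^sub>1\<close>, \<open>1\<close>, in this order.\<close>
  define a :: "nat \<Rightarrow> 'k" where "a i = (if i = 0 then 1 else 0)" for i
  have one: "1 \<in> {1..n}" using assms by simp
  have subseqs: "subseqs [1::nat] = [[1], []]" by (simp add: Let_def)
  have "a 0 = 0"
  proof (rule fock_monomials_independent[of "[1]" "\<lambda>_. 1" c a 0])
    show "(\<Sum>i<length (subseqs [1]). free_scalar (a i) * mon (subseqs [1] ! i)) \<in> J"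
      using all[OF one] by (simp add: subseqs a_def numeral_2_eq_2)
    show "\<mu> i j * \<mu> i k = 1"
      if "i \<in> set [1]" "j \<in> set [1]" "k \<in> set [1]" for i j k
      using that mu_diag[OF one] by simp
  qed (use one b[OF one one] in \<open>auto simp: b c_def\<close>)
  thus False by (simp add: a_def)
qed

abbreviation span_mod :: "nat list \<Rightarrow> ('v, 'k) free_alg set" where
  "span_mod xs \<equiv> F.span (J \<union> mon ` set (subseqs xs))"

lemma span_mod_J: "p \<in> J \<Longrightarrow> p \<in> span_mod xs"
  by (rule F.span_base) simp

lemma span_mod_mult:
  assumes "p \<in> span_mod xs" "\<And>ys. ys \<in> set (subseqs xs) \<Longrightarrow> gen i * mon ys \<in> span_mod xs'"
  shows "gen i * p \<in> span_mod xs'"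
  using assms(1)
proof (induction rule: F.span_induct_alt)
  case base
  show ?case by (simp add: F.span_zero)
next
  case (step c p q)
  have "gen i * p \<in> span_mod xs'"
    using step.hyps assms(2) span_mod_J[OF J_left] by blast
  thus ?case using step.IH
    by (simp add: distrib_left gen_scalar F.span_add F.span_scale)
qed

text \<open>
  The reordering algorithm: a generator is moved to the right past the first generator of the list,
  and the recursion takes over.
\<close>

lemma span_mod_gen:
  assumes "set xs \<subseteq> {1..n}" "i \<in> set xs" "p \<in> span_mod xs"
  shows "gen i * p \<in> span_mod xs"
  using assms
proof (induction xs arbitrary: i p)
  case Nil
  thus ?case by simp
next
  case (Cons q xs)
  have mono: "span_mod xs \<subseteq> span_mod (q # xs)"
    by (rule F.span_mono) (auto simp: Let_def)
  have q: "q \<in> {1..n}" and i: "i \<in> {1..n}" using Cons.prems by auto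
  have gen_q: "gen q * p \<in> span_mod (q # xs)" if "p \<in> span_mod xs" for p
  proof (rule span_mod_mult[OF that])
    fix ys assume "ys \<in> set (subseqs xs)"
    hence "q # ys \<in> set (subseqs (q # xs))" by (simp add: Let_def)
    from F.span_base[OF UnI2[OF imageI[OF this, of mon]]]
    show "gen q * mon ys \<in> span_mod (q # xs)" by simp
  qed
  have sub: "mon ys \<in> span_mod xs" if "ys \<in> set (subseqs xs)" for ys
    using that by (intro F.span_base) simp
  show ?case
  proof (rule span_mod_mult[OF Cons.prems(3)])
    fix ys assume "ys \<in> set (subseqs (q # xs))"
    then consider zs where "ys = q # zs" "zs \<in> set (subseqs xs)" | "ys \<in> set (subseqs xs)"
      by (auto simp: Let_def)
    thus "gen i * mon ys \<in> span_mod (q # xs)"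
    proof cases
      case (1 zs)
      show ?thesis
      proof (cases "i = q")
        case True
        have "gen i * mon ys = (gen q * gen q - free_scalar (b q q)) * mon zs
            + free_scalar (b q q) * mon zs"
          by (simp add: 1 True normalize)
        thus ?thesis
          using span_mod_J[OF J_right[OF square_in_J[OF q]]] subsetD[OF mono sub[OF 1(2)]]
          by (simp only: F.span_add F.span_scale)
      next
        case False
        hence "gen i * mon zs \<in> span_mod xs"
          using Cons.IH[OF _ _ sub[OF 1(2)]] Cons.prems by simp
        note 2 = gen_q[OF this]
        have "gen i * mon ys = rel i q * mon zs - free_scalar (\<mu> i q) * (gen q * (gen i * mon zs))
            + free_scalar (2 * b i q) * mon zs"
          by (simp add: 1 normalize)
        thus ?thesis
          using 2 span_mod_J[OF J_right[OF rel_in_J[OF i q]]] subsetD[OF mono sub[OF 1(2)]]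
          by (simp only: F.span_add F.span_diff F.span_scale)
      qed
    next
      case 2
      show ?thesis
      proof (cases "i = q")
        case True
        show ?thesis using gen_q[OF sub[OF 2]] True by simp
      next
        case False
        hence "gen i * mon ys \<in> span_mod xs"
          using Cons.IH[OF _ _ sub[OF 2]] Cons.prems by simp
        thus ?thesis using mono by blast
      qed
    qed
  qed
qed

lemma span_mod_UNIV:
  assumes "set xs \<subseteq> {1..n}"
    and red: "\<And>m. m \<in> {1..n} \<Longrightarrow> \<exists>k\<in>set xs. \<exists>c. gen m - free_scalar c * gen k \<in> J"
  shows "p \<in> span_mod xs"
proof -
  have gen: "gen m * p \<in> span_mod xs" if m: "m \<in> {1..n}" and p: "p \<in> span_mod xs" for m p
  proof -
    obtain k c where k: "k \<in> set xs" "gen m - free_scalar c * gen k \<in> J" using red[OF m] by blast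
    have "gen m * p = (gen m - free_scalar c * gen k) * p + free_scalar c * (gen k * p)"
      by (simp add: normalize)
    thus ?thesis
      using span_mod_J[OF J_right[OF k(2)]] span_mod_gen[OF assms(1) k(1) p]
      by (simp only: F.span_add F.span_scale)
  qed
  have vec: "free_gen v * p \<in> span_mod xs" if p: "p \<in> span_mod xs" for v p
  proof -
    have "v \<in> span (x ` {1..n})" using basis_span by simp
    thus ?thesis
    proof (induction rule: span_induct_alt)
      case base
      have "free_gen (0 + 0) - free_gen 0 - free_gen 0 \<in> J"
        using J_tensor unfolding tensor_relations_def by blast
      hence "free_gen 0 \<in> J" using J_uminus by fastforce
      thus ?case by (intro span_mod_J J_right)
    next
      case (step c v w)
      have J: "free_gen (scale c v + w) - free_gen (scale c v) - free_gen w \<in> J"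
          "free_gen (scale c v) - free_scalar c * free_gen v \<in> J"
        using J_tensor unfolding tensor_relations_def by blast+
      have "free_gen v * p \<in> span_mod xs" using step.hyps gen[OF _ p] by blast
      moreover have "free_gen (scale c v + w) * p =
          (free_gen (scale c v + w) - free_gen (scale c v) - free_gen w) * p
          + (free_gen (scale c v) - free_scalar c * free_gen v) * p
          + free_scalar c * (free_gen v * p) + free_gen w * p"
        by (simp add: normalize)
      ultimately show ?case
        using span_mod_J[OF J_right[OF J(1)]] span_mod_J[OF J_right[OF J(2)]] step.IH
        by (simp only: F.span_add F.span_scale)
    qed
  qed
  have words: "Poly_Mapping.single (Word vs) 1 \<in> span_mod xs" for vs
  proof (induction vs)
    case Nil
    have "[] \<in> set (subseqs xs)" by (induction xs) (auto simp: Let_def)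
    from F.span_base[OF UnI2[OF imageI[OF this, of mon]]]
    show ?case by (simp flip: zero_word_def)
  next
    case (Cons v vs)
    have "Poly_Mapping.single (Word (v # vs)) (1::'k) = free_gen v * Poly_Mapping.single (Word vs) 1"
      by (simp add: free_gen_def mult_single plus_word_def)
    thus ?case using vec[OF Cons] by simp
  qed
  show ?thesis
  proof (induction p rule: free_alg_induct)
    case (single w c)
    have "Poly_Mapping.single w c = free_scalar c * Poly_Mapping.single (Word (letters w)) 1"
      by (simp add: free_scalar_def mult_single)
    thus ?case using F.span_scale[OF words[of "letters w"], of c] by (simp only:)
  qed (rule F.span_add)
qed

lemma span_mod_combination:
  assumes "p \<in> span_mod xs"
  shows "\<exists>a. p - (\<Sum>i<length (subseqs xs). free_scalar (a i) * mon (subseqs xs ! i)) \<in> J"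
  using assms
proof (induction rule: F.span_induct_alt)
  case base
  show ?case by (intro exI[of _ "\<lambda>_. 0"]) (simp add: J_zero)
next
  case (step c p q)
  let ?N = "length (subseqs xs)" and ?m = "\<lambda>i. mon (subseqs xs ! i)"
  obtain a where a: "q - (\<Sum>i<?N. free_scalar (a i) * ?m i) \<in> J" using step.IH by blast
  have "\<exists>a'. p - (\<Sum>i<?N. free_scalar (a' i) * ?m i) \<in> J"
  proof (cases "p \<in> J")
    case True
    thus ?thesis by (intro exI[of _ "\<lambda>_. 0"]) simp
  next
    case False
    then obtain k where k: "k < ?N" "p = ?m k"
      using step.hyps by (auto simp: in_set_conv_nth)
    have "(\<Sum>i<?N. free_scalar (if i = k then 1 else 0) * ?m i) = (\<Sum>i<?N. if i = k then ?m i else 0)"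
      by (intro sum.cong) auto
    thus ?thesis using k J_zero by (intro exI[of _ "\<lambda>i. if i = k then 1 else 0"]) simp
  qed
  then obtain a' where a': "p - (\<Sum>i<?N. free_scalar (a' i) * ?m i) \<in> J" by blast
  have "free_scalar c * (p - (\<Sum>i<?N. free_scalar (a' i) * ?m i))
      + (q - (\<Sum>i<?N. free_scalar (a i) * ?m i)) \<in> J"
    using a a' by (simp only: J_add J_left)
  hence "free_scalar c * p + q - (\<Sum>i<?N. free_scalar (c * a' i + a i) * ?m i) \<in> J"
    by (simp add: right_diff_distrib sum_distrib_left free_scalar_add distrib_right sum.distrib
        algebra_simps)
  thus ?case by (intro exI[of _ "\<lambda>i. c * a' i + a i"])
qed

theorem monomial_basis:
  assumes "n \<ge> 1"
  shows "\<exists>xs. 1 \<le> length xs \<and> length xs \<le> n \<and>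
    (\<forall>a. (\<Sum>i<length (subseqs xs). free_scalar (a i) * mon (subseqs xs ! i)) \<in> J
       \<longrightarrow> (\<forall>i<length (subseqs xs). a i = 0)) \<and>
    (\<forall>p. \<exists>a. p - (\<Sum>i<length (subseqs xs). free_scalar (a i) * mon (subseqs xs ! i)) \<in> J)"
proof -
  have fin: "finite leading" unfolding leading_def by simp
  define xs where "xs = sorted_list_of_set leading"
  have xs: "distinct xs" "set xs = leading" using fin by (simp_all add: xs_def)
  obtain k0 where k0: "k0 \<in> leading" using some_generator_survives[OF assms] by blast
  \<comment> \<open>A vanishing generator is written as \<open>0\<close> times an arbitrary leading one.\<close>
  have ex: "\<exists>k c. k \<in> leading \<and> gen m - free_scalar c * gen k \<in> J \<and> (c = 0 \<longleftrightarrow> gen m \<in> J)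
      \<and> (m \<in> leading \<longrightarrow> k = m \<and> c = 1)" if "m \<in> {1..n}" for m
  proof -
    consider "gen m \<in> J" | "m \<in> leading" | "gen m \<notin> J" "m \<notin> leading" by blast
    thus ?thesis
    proof cases
      case 1
      thus ?thesis using k0 leading_not_in_J by (intro exI[of _ k0] exI[of _ 0]) auto
    next
      case 2
      thus ?thesis using J_zero leading_not_in_J by (intro exI[of _ m] exI[of _ 1]) auto
    next
      case 3
      thus ?thesis using leading_represents[OF that] by blast
    qed
  qed
  then obtain r c where rc: "\<And>m. m \<in> {1..n} \<Longrightarrow> r m \<in> leading \<and>
      gen m - free_scalar (c m) * gen (r m) \<in> J \<and> (c m = 0 \<longleftrightarrow> gen m \<in> J) \<and>
      (m \<in> leading \<longrightarrow> r m = m \<and> c m = 1)"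
    by metis
  have zero: "b m j = 0" if "m \<in> {1..n}" "j \<in> {1..n}" "c m = 0 \<or> c j = 0" for m j
    using that rc[OF that(1)] rc[OF that(2)] b_zero_of_gen_in_J[OF that(1,2)]
      b_zero_of_gen_in_J[OF that(2,1)] by blast
  have "leading \<subseteq> {1..n}" by (auto dest: leading_range)
  hence "length xs \<le> n"
    using card_mono[of "{1..n}" leading] distinct_card[OF xs(1)] xs(2) by simp
  moreover have "length xs \<ge> 1"
    using k0 distinct_card[OF xs(1)] xs(2) fin by (metis One_nat_def Suc_leI card_gt_0_iff empty_iff)
  moreover have "a i = 0"
    if "(\<Sum>i<length (subseqs xs). free_scalar (a i) * mon (subseqs xs ! i)) \<in> J"
      "i < length (subseqs xs)" for a i
  proof (rule fock_monomials_independent[OF xs(1) _ _ _ _ _ _ that, where r = r and c = c])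
    fix m j assume mj: "m \<in> {1..n}" "j \<in> {1..n}"
    note R = reduction_compatible[OF mj, of "r m" "r j" "c m" "c j"]
    show "c m * c j * b (r m) (r m) * (1 + \<mu> m j) = 2 * b m j" if "r m = r j"
    proof (cases "c m = 0 \<or> c j = 0")
      case True
      thus ?thesis using zero[OF mj] by auto
    next
      case False
      thus ?thesis using R(1) rc[OF mj(1)] rc[OF mj(2)] that by simp
    qed
    show "c m * c j * (\<mu> m j - \<mu> (r m) (r j)) = 0 \<and> c m * c j * b (r m) (r j) = b m j"
      if "r m \<noteq> r j"
    proof (cases "c m = 0 \<or> c j = 0")
      case True
      thus ?thesis using zero[OF mj] by auto
    next
      case False
      thus ?thesis using R(2) rc[OF mj(1)] rc[OF mj(2)] that by simp
    qed
  qed (use xs(2) rc leading_range leading_homogeneous in \<open>auto simp del: atLeastAtMost_iff\<close>)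
  moreover have "p \<in> span_mod xs" for p
    by (rule span_mod_UNIV) (use xs(2) rc leading_range in blast)+
  ultimately show ?thesis using span_mod_combination by blast
qed

end

section \<open>Transfer to the quotient rings\<close>

lemma ring_of_type_algebra_simps:
  "carrier ring_of_type_algebra = UNIV"
  "p \<otimes>\<^bsub>ring_of_type_algebra\<^esub> q = p * q"
  "p \<oplus>\<^bsub>ring_of_type_algebra\<^esub> q = p + q"
  "\<one>\<^bsub>ring_of_type_algebra\<^esub> = 1"
  "\<zero>\<^bsub>ring_of_type_algebra\<^esub> = 0"
  by (simp_all add: ring_of_type_algebra_def)

text \<open>
  A homomorphism from the carrier-based copy of a ring type turns type class operations into the
  operations of the target; this hides the copy from all further statements.
\<close>

locale type_ring_hom = ring S for S :: "'s ring" (structure) +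
  fixes h :: "'r::ring_1 \<Rightarrow> 's"
  assumes hom: "h \<in> ring_hom ring_of_type_algebra S"
begin

lemma map_closed [simp]: "h p \<in> carrier S"
  using ring_hom_closed[OF hom] by (simp add: ring_of_type_algebra_simps)

lemma map_add: "h (p + q) = h p \<oplus> h q"
  using ring_hom_add[OF hom, of p q] by (simp add: ring_of_type_algebra_simps)

lemma map_mult: "h (p * q) = h p \<otimes> h q"
  using ring_hom_mult[OF hom, of p q] by (simp add: ring_of_type_algebra_simps)

lemma map_one: "h 1 = \<one>"
  using ring_hom_one[OF hom] by (simp add: ring_of_type_algebra_simps)

lemma map_zero: "h 0 = \<zero>"
  using map_add[of 0 0] by (simp add: add.l_cancel_one')

lemma map_uminus: "h (- p) = \<ominus> h p"
  by (rule minus_equality[symmetric]) (simp_all add: map_zero flip: map_add)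

lemma map_diff: "h (p - q) = h p \<ominus> h q"
  using map_add[of p "- q"] by (simp add: map_uminus minus_eq)

lemma map_eq_iff: "h p = h q \<longleftrightarrow> h (p - q) = \<zero>"
  by (simp add: map_diff)

end

lemma quotient_zero: "\<zero>\<^bsub>R Quot I\<^esub> = I"
  by (simp add: FactRing_def)

lemma quotient_carrier: "carrier (R Quot I) = (\<Union>a\<in>carrier R. {I +>\<^bsub>R\<^esub> a})"
  by (simp add: FactRing_def A_RCOSETS_def')

lemma (in ideal) coset_eq_ideal_iff:
  assumes "p \<in> carrier R"
  shows "I +> p = I \<longleftrightarrow> p \<in> I"
proof
  assume "I +> p = I"
  thus "p \<in> I" by (rule rcos_const_imp_mem[OF assms])
next
  assume "p \<in> I"
  thus "I +> p = I" by (rule a_rcos_const)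
qed

context
  fixes scale :: "'k::field \<Rightarrow> 'v::ab_group_add \<Rightarrow> 'v" and n :: nat and x :: "nat \<Rightarrow> 'v"
    and \<mu> :: "nat \<Rightarrow> nat \<Rightarrow> 'k" and \<phi> :: "'v \<Rightarrow> 'v \<Rightarrow> 'k"
begin

abbreviation T_class :: "('v, 'k) free_alg \<Rightarrow> ('v, 'k) free_alg set" where
  "T_class p \<equiv> tensor_ideal scale +>\<^bsub>ring_of_type_algebra\<^esub> p"

definition sCl_class :: "('v, 'k) free_alg \<Rightarrow> ('v, 'k) free_alg set set" where
  "sCl_class p = skew_clifford_ideal scale n x \<mu> \<phi> +>\<^bsub>tensor_algebra scale\<^esub> T_class p"

interpretation T: type_ring_hom "tensor_algebra scale" T_class
proof (rule type_ring_hom.intro)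
  show "ring (tensor_algebra scale)" by (rule ring_tensor_algebra)
  show "type_ring_hom_axioms (tensor_algebra scale) T_class"
    unfolding type_ring_hom_axioms_def by (rule tensor_proj_hom)
qed

interpretation A: type_ring_hom "sCl scale n x \<mu> \<phi>" sCl_class
proof (intro type_ring_hom.intro type_ring_hom_axioms.intro ring_sCl)
  have "a_r_coset (tensor_algebra scale) (skew_clifford_ideal scale n x \<mu> \<phi>)
      \<in> ring_hom (tensor_algebra scale) (sCl scale n x \<mu> \<phi>)"
    unfolding sCl_def by (rule ideal.rcos_ring_hom[OF ideal_skew_clifford_ideal])
  moreover have "sCl_class =
      a_r_coset (tensor_algebra scale) (skew_clifford_ideal scale n x \<mu> \<phi>) \<circ> T_class"
    by (simp add: fun_eq_iff sCl_class_def)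
  ultimately show "sCl_class \<in> ring_hom ring_of_type_algebra (sCl scale n x \<mu> \<phi>)"
    using ring_hom_trans[OF tensor_proj_hom] by simp
qed

lemma T_class_surj: "t \<in> carrier (tensor_algebra scale) \<Longrightarrow> \<exists>p. t = T_class p"
  unfolding tensor_algebra_def quotient_carrier by blast

lemma sCl_class_surj: "a \<in> carrier (sCl scale n x \<mu> \<phi>) \<Longrightarrow> \<exists>p. a = sCl_class p"
  unfolding sCl_def sCl_class_def quotient_carrier using T_class_surj by blast

lemma T_class_zero_iff: "T_class p = \<zero>\<^bsub>tensor_algebra scale\<^esub> \<longleftrightarrow> p \<in> tensor_ideal scale"
  unfolding tensor_algebra_def quotient_zero
  by (rule ideal.coset_eq_ideal_iff[OF ideal_tensor_ideal]) (simp add: ring_of_type_algebra_simps)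

lemma sCl_class_zero_iff:
  "sCl_class p = \<zero>\<^bsub>sCl scale n x \<mu> \<phi>\<^esub> \<longleftrightarrow> T_class p \<in> skew_clifford_ideal scale n x \<mu> \<phi>"
  unfolding sCl_def sCl_class_def quotient_zero
  by (rule ideal.coset_eq_ideal_iff[OF ideal_skew_clifford_ideal T.map_closed])

lemma sCl_class_eq_iff:
  "sCl_class p = sCl_class q \<longleftrightarrow> sCl_class (p - q) = \<zero>\<^bsub>sCl scale n x \<mu> \<phi>\<^esub>"
  by (rule A.map_eq_iff)

lemma sCl_scalar_eq_class: "sCl_scalar scale n x \<mu> \<phi> c = sCl_class (free_scalar c)"
  by (simp add: sCl_scalar_def sCl_class_def tensor_scalar_def)

abbreviation free_relation :: "nat \<Rightarrow> nat \<Rightarrow> ('v, 'k) free_alg" where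
  "free_relation i j \<equiv>
     free_gen (x i) * free_gen (x j) + free_scalar (\<mu> i j) * (free_gen (x j) * free_gen (x i))
       - free_scalar (2 * \<phi> (x i) (x j))"

lemma skew_clifford_relations_eq:
  "skew_clifford_relations scale n x \<mu> \<phi> =
     {T_class (free_relation i j) | i j. i \<in> {1..n} \<and> j \<in> {1..n}}"
  unfolding skew_clifford_relations_def Let_def tensor_gen_def tensor_scalar_def
  by (simp only: T.map_add T.map_mult T.map_diff)

lemma tensor_relations_subset_ideal: "tensor_relations scale \<subseteq> tensor_ideal scale"
  unfolding tensor_ideal_def
  by (rule ring.genideal_self[OF ring_ring_of_type_algebra]) (simp add: ring_of_type_algebra_simps)

lemma relations_subset_skew_clifford_ideal:
  "skew_clifford_relations scale n x \<mu> \<phi> \<subseteq> skew_clifford_ideal scale n x \<mu> \<phi>"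
  unfolding skew_clifford_ideal_def
  by (rule ring.genideal_self[OF ring_tensor_algebra]) (auto simp: skew_clifford_relations_eq)

text \<open>
  The skew Clifford algebra is a quotient of a quotient, and the two generated ideals are minimal each in
  its own ring.  An ideal \<open>K\<close> containing all relations contains the tensor ideal, so its image in the
  tensor algebra is an ideal whose preimage is \<open>K\<close> again.
\<close>

lemma kernel_least:
  assumes add: "\<And>p q. p \<in> K \<Longrightarrow> q \<in> K \<Longrightarrow> p + q \<in> K"
    and left: "\<And>p r. p \<in> K \<Longrightarrow> r * p \<in> K" and right: "\<And>p r. p \<in> K \<Longrightarrow> p * r \<in> K"
    and tensor: "tensor_relations scale \<subseteq> K"
    and rel: "\<And>i j. i \<in> {1..n} \<Longrightarrow> j \<in> {1..n} \<Longrightarrow> free_relation i j \<in> K"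
    and p: "sCl_class p = \<zero>\<^bsub>sCl scale n x \<mu> \<phi>\<^esub>"
  shows "p \<in> K"
proof -
  have "free_gen (0 + 0) - free_gen 0 - free_gen 0 \<in> tensor_relations scale"
    unfolding tensor_relations_def by blast
  from left[OF subsetD[OF tensor this], of 0] have zero: "0 \<in> K" by simp
  have uminus: "- q \<in> K" if "q \<in> K" for q using left[OF that, of "-1"] by simp
  interpret R: ring "ring_of_type_algebra :: ('v, 'k) free_alg ring"
    by (rule ring_ring_of_type_algebra)
  interpret id: type_ring_hom "ring_of_type_algebra :: ('v, 'k) free_alg ring" "\<lambda>p. p"
    by unfold_locales (rule ring_hom_memI; simp)
  have "ideal K (ring_of_type_algebra :: ('v, 'k) free_alg ring)"
  proof (rule idealI[OF R.ring_axioms])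
    show "subgroup K (add_monoid (ring_of_type_algebra :: ('v, 'k) free_alg ring))"
    proof (rule R.add.subgroupI)
      show "\<ominus>\<^bsub>ring_of_type_algebra\<^esub> a \<in> K" if "a \<in> K" for a
        unfolding id.map_uminus[symmetric] by (rule uminus[OF that])
    qed (use zero add in \<open>auto simp: ring_of_type_algebra_simps\<close>)
  qed (simp_all add: ring_of_type_algebra_simps left right)
  hence K: "tensor_ideal scale \<subseteq> K"
    unfolding tensor_ideal_def using tensor by (rule R.genideal_minimal)
  have "ideal (T_class ` K) (tensor_algebra scale)"
  proof (rule idealI[OF ring_tensor_algebra])
    show "subgroup (T_class ` K) (add_monoid (tensor_algebra scale))"
    proof (rule T.add.subgroupI)
      show "T_class ` K \<subseteq> carrier (tensor_algebra scale)" by (rule image_subsetI) (rule T.map_closed)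
      show "T_class ` K \<noteq> {}" using zero by blast
    next
      fix a assume "a \<in> T_class ` K"
      then obtain q where q: "q \<in> K" "a = T_class q" by blast
      have "\<ominus>\<^bsub>tensor_algebra scale\<^esub> a = T_class (- q)"
        by (simp only: q(2) T.map_uminus)
      thus "\<ominus>\<^bsub>tensor_algebra scale\<^esub> a \<in> T_class ` K" using uminus[OF q(1)] by blast
    next
      fix a a' assume "a \<in> T_class ` K" "a' \<in> T_class ` K"
      then obtain q q' where "q \<in> K" "q' \<in> K" "a = T_class q" "a' = T_class q'" by blast
      thus "a \<oplus>\<^bsub>tensor_algebra scale\<^esub> a' \<in> T_class ` K"
        using add by (simp only: imageI flip: T.map_add)
    qed
  next
    fix a t assume "a \<in> T_class ` K" "t \<in> carrier (tensor_algebra scale)"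
    then obtain q r where "q \<in> K" "a = T_class q" "t = T_class r" using T_class_surj by blast
    thus "t \<otimes>\<^bsub>tensor_algebra scale\<^esub> a \<in> T_class ` K" "a \<otimes>\<^bsub>tensor_algebra scale\<^esub> t \<in> T_class ` K"
      using left right by (simp_all only: imageI flip: T.map_mult)
  qed
  hence "skew_clifford_ideal scale n x \<mu> \<phi> \<subseteq> T_class ` K"
    unfolding skew_clifford_ideal_def
    by (rule T.genideal_minimal) (use rel in \<open>unfold skew_clifford_relations_eq, blast\<close>)
  moreover have "T_class p \<in> skew_clifford_ideal scale n x \<mu> \<phi>"
    using p by (simp only: sCl_class_zero_iff)
  ultimately obtain q where q: "q \<in> K" "T_class p = T_class q" by blast
  have "T_class (p - q) = \<zero>\<^bsub>tensor_algebra scale\<^esub>"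
    using q(2) by (simp only: T.map_eq_iff)
  hence "p - q \<in> K" using K by (simp only: T_class_zero_iff subset_iff)
  from add[OF this q(1)] show ?thesis by simp
qed

lemma skew_clifford_kernel_sCl:
  assumes "CHAR('k) \<noteq> 2" "vector_space scale" "ordered_basis scale n x"
    "mult_antisymmetric n \<mu>" "mu_symmetric n x \<mu> \<phi>"
    "carrier (sCl scale n x \<mu> \<phi>) \<noteq> {\<zero>\<^bsub>sCl scale n x \<mu> \<phi>\<^esub>}"
  shows "skew_clifford_kernel scale n x \<mu> \<phi> {p. sCl_class p = \<zero>\<^bsub>sCl scale n x \<mu> \<phi>\<^esub>}"
proof (intro skew_clifford_kernel.intro skew_clifford_kernel_axioms.intro assms)
  show "(2::'k) \<noteq> 0"
  proof
    assume "(2::'k) = 0"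
    hence "CHAR('k) dvd 2" using of_nat_eq_0_iff_char_dvd[of 2, where 'a = 'k] by simp
    thus False
      using assms(1) CHAR_not_1'[where 'a = 'k] dvd_imp_le[of "CHAR('k)" 2]
      by (cases "CHAR('k) = 0") (auto simp: le_Suc_eq numeral_2_eq_2)
  qed
  show "tensor_relations scale \<subseteq> {p. sCl_class p = \<zero>\<^bsub>sCl scale n x \<mu> \<phi>\<^esub>}"
  proof
    fix p assume "p \<in> tensor_relations scale"
    hence "T_class p = \<zero>\<^bsub>tensor_algebra scale\<^esub>"
      using tensor_relations_subset_ideal T_class_zero_iff by blast
    moreover have "\<zero>\<^bsub>tensor_algebra scale\<^esub> \<in> skew_clifford_ideal scale n x \<mu> \<phi>"
      using ideal_skew_clifford_ideal by (meson additive_subgroup.zero_closed ideal.axioms(1))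
    ultimately show "p \<in> {p. sCl_class p = \<zero>\<^bsub>sCl scale n x \<mu> \<phi>\<^esub>}"
      by (simp add: sCl_class_zero_iff)
  qed
  show "free_relation i j \<in> {p. sCl_class p = \<zero>\<^bsub>sCl scale n x \<mu> \<phi>\<^esub>}"
    if "i \<in> {1..n}" "j \<in> {1..n}" for i j
    unfolding mem_Collect_eq sCl_class_zero_iff
    using that relations_subset_skew_clifford_ideal unfolding skew_clifford_relations_eq by blast
  have "\<one>\<^bsub>sCl scale n x \<mu> \<phi>\<^esub> \<noteq> \<zero>\<^bsub>sCl scale n x \<mu> \<phi>\<^esub>"
    using A.one_zeroD assms(6) by blast
  thus "1 \<notin> {p. sCl_class p = \<zero>\<^bsub>sCl scale n x \<mu> \<phi>\<^esub>}" by (simp add: A.map_one)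
  show "{p. sCl_class p = \<zero>\<^bsub>sCl scale n x \<mu> \<phi>\<^esub>} \<subseteq> K"
    if "\<And>p q. p \<in> K \<Longrightarrow> q \<in> K \<Longrightarrow> p + q \<in> K" "\<And>p r. p \<in> K \<Longrightarrow> r * p \<in> K"
      "\<And>p r. p \<in> K \<Longrightarrow> p * r \<in> K" "tensor_relations scale \<subseteq> K"
      "\<And>i j. i \<in> {1..n} \<Longrightarrow> j \<in> {1..n} \<Longrightarrow> free_relation i j \<in> K" for K
    using kernel_least[OF that] by blast
qed (simp_all add: A.map_add A.map_mult)

lemma combine_classes:
  assumes "length cs = length ms"
  shows "A.combine (map (sCl_scalar scale n x \<mu> \<phi>) cs) (map sCl_class ms) =
    sCl_class (\<Sum>i<length ms. free_scalar (cs ! i) * ms ! i)"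
  using assms
proof (induction cs ms rule: list_induct2)
  case Nil
  show ?case by (simp add: A.map_zero)
next
  case (Cons c cs m ms)
  thus ?case
    by (simp add: sum.lessThan_Suc_shift A.map_add A.map_mult sCl_scalar_eq_class del: sum.lessThan_Suc)
qed

lemma sCl_has_dim_of_basis:
  assumes "carrier (sCl scale n x \<mu> \<phi>) \<noteq> {\<zero>\<^bsub>sCl scale n x \<mu> \<phi>\<^esub>}"
    and ind: "\<And>a i. sCl_class (\<Sum>i<length ms. free_scalar (a i) * ms ! i) = \<zero>\<^bsub>sCl scale n x \<mu> \<phi>\<^esub>
      \<Longrightarrow> i < length ms \<Longrightarrow> a i = 0"
    and span: "\<And>p. \<exists>a. sCl_class p = sCl_class (\<Sum>i<length ms. free_scalar (a i) * ms ! i)"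
  shows "sCl_has_dim scale n x \<mu> \<phi> (length ms)"
proof -
  let ?s = "sCl_scalar scale n x \<mu> \<phi>"
  let ?K = "range ?s" and ?Us = "map sCl_class ms"
  have K: "subfield ?K (sCl scale n x \<mu> \<phi>)" by (rule subfield_sCl_scalars[OF assms(1)])
  have Us: "set ?Us \<subseteq> carrier (sCl scale n x \<mu> \<phi>)" by auto
  have K_carrier: "?K \<subseteq> carrier (sCl scale n x \<mu> \<phi>)" by (auto simp: sCl_scalar_eq_class)
  have zero: "?s 0 = \<zero>\<^bsub>sCl scale n x \<mu> \<phi>\<^esub>" by (simp add: sCl_scalar_eq_class A.map_zero)
  have "A.independent ?K ?Us"
  proof (rule A.trivial_combine_imp_independent[OF K Us])
    fix Ks assume Ks: "set Ks \<subseteq> ?K" and comb: "A.combine Ks ?Us = \<zero>\<^bsub>sCl scale n x \<mu> \<phi>\<^esub>"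
    have "set Ks \<subseteq> carrier (sCl scale n x \<mu> \<phi>)" using Ks K_carrier by blast
    from A.combine_normalize[OF this Us comb]
    obtain Ks' where Ks': "set (take (length ?Us) Ks) \<subseteq> set Ks'"
        "set Ks' \<subseteq> set (take (length ?Us) Ks) \<union> {\<zero>\<^bsub>sCl scale n x \<mu> \<phi>\<^esub>}"
        "length Ks' = length ?Us" "A.combine Ks' ?Us = \<zero>\<^bsub>sCl scale n x \<mu> \<phi>\<^esub>"
      by blast
    have "\<zero>\<^bsub>sCl scale n x \<mu> \<phi>\<^esub> \<in> ?K" using zero by (metis rangeI)
    hence "set Ks' \<subseteq> ?K"
      using Ks'(2) Ks set_take_subset[of "length ?Us" Ks] by blast
    hence "\<exists>cs. Ks' = map ?s cs" by (simp add: ex_map_conv subset_iff image_iff)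
    then obtain cs where cs: "Ks' = map ?s cs" by blast
    have len: "length cs = length ms" using Ks'(3) cs by simp
    have "cs ! i = 0" if "i < length ms" for i
      using ind[OF _ that, of "(!) cs"] Ks'(4) combine_classes[OF len] cs by simp
    hence "set Ks' \<subseteq> {\<zero>\<^bsub>sCl scale n x \<mu> \<phi>\<^esub>}"
      using zero len by (auto simp: cs in_set_conv_nth)
    thus "set (take (length ?Us) Ks) \<subseteq> {\<zero>\<^bsub>sCl scale n x \<mu> \<phi>\<^esub>}" using Ks'(1) by blast
  qed
  from A.dimension_independent[OF this]
  have "A.dimension (length ms) ?K (A.Span ?K ?Us)" by simp
  moreover have "A.Span ?K ?Us = carrier (sCl scale n x \<mu> \<phi>)"
  proof
    show "A.Span ?K ?Us \<subseteq> carrier (sCl scale n x \<mu> \<phi>)"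
      by (rule A.Span_in_carrier[OF K_carrier Us])
    show "carrier (sCl scale n x \<mu> \<phi>) \<subseteq> A.Span ?K ?Us"
    proof
      fix u assume "u \<in> carrier (sCl scale n x \<mu> \<phi>)"
      then obtain p where p: "u = sCl_class p" using sCl_class_surj by blast
      obtain a where a: "sCl_class p = sCl_class (\<Sum>i<length ms. free_scalar (a i) * ms ! i)"
        using span by blast
      have "(\<Sum>i<length ms. free_scalar (a i) * ms ! i) =
          (\<Sum>i<length ms. free_scalar (map a [0..<length ms] ! i) * ms ! i)"
        by (intro sum.cong) auto
      hence "u = sCl_class (\<Sum>i<length ms. free_scalar (map a [0..<length ms] ! i) * ms ! i)"
        by (simp only: p a)
      also have "\<dots> = A.combine (map ?s (map a [0..<length ms])) ?Us"
        by (rule combine_classes[symmetric]) simp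
      finally have "u = A.combine (map ?s (map a [0..<length ms])) ?Us" .
      moreover have "set (map ?s (map a [0..<length ms])) \<subseteq> ?K" by auto
      ultimately show "u \<in> A.Span ?K ?Us"
        unfolding A.Span_eq_combine_set[OF K Us] by blast
    qed
  qed
  ultimately show ?thesis by (simp add: sCl_has_dim_def)
qed

end

theorem corollary3p13:
  fixes scale :: "'k::field \<Rightarrow> 'v::ab_group_add \<Rightarrow> 'v"
    and n :: nat
    and x :: "nat \<Rightarrow> 'v"
    and \<mu> :: "nat \<Rightarrow> nat \<Rightarrow> 'k"
    and \<phi> :: "'v \<Rightarrow> 'v \<Rightarrow> 'k"
  assumes "CHAR('k) \<noteq> 2"
    and "n \<ge> 1"
    and "vector_space scale"
    and "ordered_basis scale n x"
    and "mult_antisymmetric n \<mu>"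
    and "bilinear_form scale \<phi>"
    and "mu_symmetric n x \<mu> \<phi>"
    and "carrier (sCl scale n x \<mu> \<phi>) \<noteq> {\<zero>\<^bsub>sCl scale n x \<mu> \<phi>\<^esub>}"
  shows "\<exists>j::nat. 1 \<le> j \<and> j \<le> vector_space.dim scale (UNIV :: 'v set) \<and>
             sCl_has_dim scale n x \<mu> \<phi> (2 ^ j)"
proof -
  let ?cl = "sCl_class scale n x \<mu> \<phi>" and ?A = "sCl scale n x \<mu> \<phi>"
  interpret skew_clifford_kernel scale n x \<mu> \<phi> "{p. ?cl p = \<zero>\<^bsub>?A\<^esub>}"
    by (rule skew_clifford_kernel_sCl[OF assms(1,3,4,5,7,8)])
  have dim: "dim (UNIV :: 'v set) = n"
    using dim_eq_card[of "x ` {1..n}" UNIV] basis_span basis_independent card_image[OF basis_inj]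
    by simp
  obtain xs where xs: "1 \<le> length xs" "length xs \<le> n"
    and ind: "\<And>a i. ?cl (\<Sum>i<length (subseqs xs). free_scalar (a i) * mon (subseqs xs ! i)) = \<zero>\<^bsub>?A\<^esub>
      \<Longrightarrow> i < length (subseqs xs) \<Longrightarrow> a i = 0"
    and span: "\<And>p. \<exists>a. ?cl (p - (\<Sum>i<length (subseqs xs). free_scalar (a i) * mon (subseqs xs ! i))) = \<zero>\<^bsub>?A\<^esub>"
    using monomial_basis[OF assms(2)] unfolding mem_Collect_eq by blast
  have "sCl_has_dim scale n x \<mu> \<phi> (length (map mon (subseqs xs)))"
  proof (rule sCl_has_dim_of_basis[OF assms(8)])
    fix a i assume "?cl (\<Sum>i<length (map mon (subseqs xs)). free_scalar (a i) * map mon (subseqs xs) ! i) = \<zero>\<^bsub>?A\<^esub>"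
      "i < length (map mon (subseqs xs))"
    thus "a i = 0" using ind[of a i] by simp
  next
    fix p
    show "\<exists>a. ?cl p = ?cl (\<Sum>i<length (map mon (subseqs xs)). free_scalar (a i) * map mon (subseqs xs) ! i)"
      using span[of p] by (simp add: sCl_class_eq_iff)
  qed
  thus ?thesis using xs dim by (auto simp: length_subseqs)
qed

end
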